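(* Let $L/k$ be a proper field extension such that $k$ is algebraically closed in $L$ and $L\otimes_k L$ is a domain, and let $\sigma$ be a $k$-automorphism of $L$ such that $k=L^{\langle\sigma\rangle}$. Let $\Delta=\sigma-\mathrm{id}:L\to L$. Let $A$ be a $k$-subalgebra of $L$ with $\operatorname{Frac}(A)=L$ and $\Delta(L)\cap A\subset k$, and let $f\in A\setminus k$. Then the elements $f$ and $t(1-t)^{-1}f$ generate a free $k$-subalgebra in $D=L(t;\sigma)$ (that is, they are free generators of a free associative $k$-algebra of rank $2$: distinct monomials in these two elements are linearly independent over $k$).
   Context: $L^{\langle\sigma\rangle}=\{x\in L:\sigma(x)=x\}$ is the fixed field of $\sigma$. $L[t;\sigma]$ is the skew polynomial ring in the variable $t$, with multiplication determined by $a\,t=t\,\sigma(a)$ for $a\in L$, and $L(t;\sigma)$ is its division ring of fractions. $\operatorname{Frac}(A)$ denotes the field of fractions of $A$ (inside $L$). *)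

theory Defs
  imports "HOL-Algebra.Algebra"
begin

section \<open>The tensor product \<open>L \<otimes>\<^sub>K L\<close>\<close>

text \<open>
  The tensor product is the free abelian group on the pairs \<open>(a, b)\<close> modulo the subgroup generated
  by the usual bilinearity and balancing relations. The free abelian group carries the
  multiplication \<open>(a, b) (c, d) = (a c, b d)\<close>, extended biadditively. The set of relations is
  stable, up to sign, under multiplication by pairs, so the subgroup it generates is the ideal it
  generates, and the quotient ring below is the tensor product with its usual ring structure.
\<close>

definition pair_ring :: "('a, 'm) ring_scheme \<Rightarrow> ('a \<times> 'a \<Rightarrow>\<^sub>0 int) ring" where
  "pair_ring L =
    \<lparr> carrier = carrier (free_Abelian_group (carrier L \<times> carrier L)),
      monoid.mult = (\<lambda>x y. frag_extend (\<lambda>(a, b). frag_extend (\<lambda>(c, d).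
               frag_of (a \<otimes>\<^bsub>L\<^esub> c, b \<otimes>\<^bsub>L\<^esub> d)) y) x),
      one = frag_of (\<one>\<^bsub>L\<^esub>, \<one>\<^bsub>L\<^esub>),
      ring.zero = 0,
      add = (+) \<rparr>"

definition tensor_relations :: "('a, 'm) ring_scheme \<Rightarrow> 'a set \<Rightarrow> ('a \<times> 'a \<Rightarrow>\<^sub>0 int) set" where
  "tensor_relations L K =
    {frag_of (a \<oplus>\<^bsub>L\<^esub> b, c) - frag_of (a, c) - frag_of (b, c) |a b c.
       a \<in> carrier L \<and> b \<in> carrier L \<and> c \<in> carrier L} \<union>
    {frag_of (a, b \<oplus>\<^bsub>L\<^esub> c) - frag_of (a, b) - frag_of (a, c) |a b c.
       a \<in> carrier L \<and> b \<in> carrier L \<and> c \<in> carrier L} \<union>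
    {frag_of (r \<otimes>\<^bsub>L\<^esub> a, b) - frag_of (a, r \<otimes>\<^bsub>L\<^esub> b) |r a b.
       r \<in> K \<and> a \<in> carrier L \<and> b \<in> carrier L}"

definition tensor_square :: "('a, 'm) ring_scheme \<Rightarrow> 'a set \<Rightarrow> ('a \<times> 'a \<Rightarrow>\<^sub>0 int) set ring" where
  "tensor_square L K = pair_ring L Quot (Idl\<^bsub>pair_ring L\<^esub> (tensor_relations L K))"

section \<open>Skew polynomials and fractions\<close>

text \<open>
  The skew polynomial ring \<open>L[t;\<sigma>]\<close> consists of the sums \<open>\<Sum>i. t\<^sup>i p\<^sub>i\<close>, with coefficients on the
  right of \<open>t\<close>. It has the additive structure of \<^term>\<open>UP L\<close>, and \<open>a t = t \<sigma>(a)\<close> gives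
  \<open>(t\<^sup>i a) (t\<^sup>j b) = t\<^sup>i\<^sup>+\<^sup>j \<sigma>\<^sup>j(a) b\<close>.
  As in \<^term>\<open>UP L\<close>, \<open>monom P a 0\<close> is the constant \<open>a\<close> and \<open>monom P \<one> 1\<close> is the variable.
\<close>

definition skew_poly :: "('a, 'm) ring_scheme \<Rightarrow> ('a \<Rightarrow> 'a) \<Rightarrow> ('a, nat \<Rightarrow> 'a) up_ring" where
  "skew_poly L \<sigma> = (UP L)\<lparr> monoid.mult :=
     (\<lambda>p\<in>up L. \<lambda>q\<in>up L. \<lambda>n. \<Oplus>\<^bsub>L\<^esub>i \<in> {..n}. (\<sigma> ^^ (n - i)) (p i) \<otimes>\<^bsub>L\<^esub> q (n - i)) \<rparr>"

text \<open>
  \<open>D\<close>, with the embedding \<open>\<iota>\<close>, is a division ring of (right) fractions of the possibly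
  noncommutative ring \<open>R\<close>. Such a \<open>D\<close> is determined by \<open>R\<close> up to unique isomorphism over \<open>R\<close>.
\<close>

definition division_ring_of_fractions ::
    "('a, 'm) ring_scheme \<Rightarrow> ('d, 'n) ring_scheme \<Rightarrow> ('a \<Rightarrow> 'd) \<Rightarrow> bool" where
  "division_ring_of_fractions R D \<iota> \<longleftrightarrow>
     ring D \<and> Units D = carrier D - {\<zero>\<^bsub>D\<^esub>} \<and>
     \<iota> \<in> ring_hom R D \<and> inj_on \<iota> (carrier R) \<and>
     (\<forall>x \<in> carrier D. \<exists>p \<in> carrier R. \<exists>q \<in> carrier R - {\<zero>\<^bsub>R\<^esub>}. x = \<iota> p \<otimes>\<^bsub>D\<^esub> inv\<^bsub>D\<^esub> (\<iota> q))"

definition Frac_in :: "('a, 'm) ring_scheme \<Rightarrow> 'a set \<Rightarrow> 'a set" where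
  "Frac_in L A = {a \<otimes>\<^bsub>L\<^esub> inv\<^bsub>L\<^esub> b |a b. a \<in> A \<and> b \<in> A - {\<zero>\<^bsub>L\<^esub>}}"

section \<open>Free generators\<close>

definition word_value :: "('d, 'n) ring_scheme \<Rightarrow> ('i \<Rightarrow> 'd) \<Rightarrow> 'i list \<Rightarrow> 'd" where
  "word_value D g w = foldr (\<lambda>i m. g i \<otimes>\<^bsub>D\<^esub> m) w \<one>\<^bsub>D\<^esub>"

text \<open>
  The family \<open>g\<close> freely generates a free associative algebra over the central subfield \<open>K\<close> of \<open>D\<close>:
  the monomials belonging to distinct words are distinct and linearly independent over \<open>K\<close>.
\<close>

definition free_generators :: "('d, 'n) ring_scheme \<Rightarrow> 'd set \<Rightarrow> ('i \<Rightarrow> 'd) \<Rightarrow> bool" where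
  "free_generators D K g \<longleftrightarrow>
     range g \<subseteq> carrier D \<and>
     (\<forall>W c. finite W \<longrightarrow> c \<in> W \<rightarrow> K \<longrightarrow>
        (\<Oplus>\<^bsub>D\<^esub>w \<in> W. c w \<otimes>\<^bsub>D\<^esub> word_value D g w) = \<zero>\<^bsub>D\<^esub> \<longrightarrow>
        (\<forall>w \<in> W. c w = \<zero>\<^bsub>D\<^esub>))"

end

theory Submission
  imports Defs
begin

text \<open>
  Write \<open>u = t (1 - t)\<^sup>-\<^sup>1\<close> and, for exponents \<open>i\<^sub>1, \<dots>, i\<^sub>n\<close>, let
  \<open>Y [i\<^sub>1, \<dots>, i\<^sub>n] = u f\<^sup>i u \<dots> u f\<^sup>j u\<close> be the product in which \<open>n + 1\<close> copies of \<open>u\<close> are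
  separated by the powers of \<open>f\<close> with these exponents. A monomial in \<open>f\<close> and \<open>u f\<close> is either a
  power of \<open>f\<close> or of the form \<open>f\<^sup>i (Y v) f\<^sup>j\<close> with \<open>j\<close> and all entries of \<open>v\<close> positive. A linear
  relation between monomials is therefore a relation between the elements \<open>Y v\<close> in which an
  element \<open>a \<otimes> b\<close> of \<open>L \<otimes>\<^sub>k L\<close> acts by \<open>x \<mapsto> a x b\<close>, up to an additive error in \<open>L\<close>.

  The idea is that the elements \<open>Y v\<close> behave like iterated integrals. Let \<open>s = t\<^sup>-\<^sup>1\<close>. Then
  \<open>s a = \<sigma>(a) s\<close> for \<open>a\<close> in \<open>L\<close> and \<open>s u = u + 1\<close>, so that
  \<open>s (Y (i # v)) = Y (i # v) + f\<^sup>i (Y v)\<close>: left multiplication by \<open>s\<close> acts as a difference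
  operator that removes the first letter, and it acts on coefficients as \<open>\<sigma> \<otimes> id\<close>. Iterated
  integrals are independent if their integrands are independent modulo derivatives. Here this
  condition says that no nontrivial combination over \<open>k\<close> of positive powers of \<open>f\<close> lies in
  \<open>\<Delta>(L)\<close>. It holds because such a combination lies in \<open>A\<close>, so if it is in \<open>\<Delta>(L)\<close>, then it lies
  in \<open>k\<close> and \<open>f\<close> is algebraic over \<open>k\<close>.

  Everything is done modulo Laurent polynomials in \<open>t\<close>, a bimodule over \<open>L\<close> that is stable under
  \<open>s\<close> and does not contain \<open>u\<close> (lemma \<open>u_not_laurent\<close>). Three facts carry the argument.

  \<^item> \<open>bimodule_simplicity\<close>: the coefficients that can occur at the longest word of a relation form
    an ideal of \<open>L \<otimes>\<^sub>k L\<close> that is stable under \<open>\<sigma> \<otimes> id\<close>. Since \<open>k\<close> is the fixed field of \<open>\<sigma>\<close>, such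
    an ideal is generated by elements \<open>1 \<otimes> b\<close>, so that it is zero or contains \<open>1\<close>.

  \<^item> \<open>tensor_separation\<close>: if \<open>\<Sum> g x d = 0\<close> for all \<open>x\<close> in the division ring, then the tensor
    \<open>\<Sum> g \<otimes> d\<close> is zero over \<open>k\<close>. The lemma states the consequences of this that are needed,
    in terms of \<open>k\<close>-subspaces of \<open>L\<close>.

  \<^item> \<open>words_independent\<close>: a relation between the \<open>Y v\<close> is trivial. In a minimal counterexample
    the coefficient at a longest word \<open>j # v\<close> can be taken to be \<open>1\<close>. Applying \<open>s - 1\<close> gives a
    smaller relation, which is trivial. Hence the coefficients at all longest words are of the
    form \<open>1 \<otimes> c\<close>, and comparing coefficients at \<open>v\<close> expresses \<open>f\<^sup>j\<close> as an element of \<open>\<Delta>(L)\<close>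
    plus a combination of other powers of \<open>f\<close>.
\<close>

section \<open>A division ring generated by a field and a variable\<close>

text \<open>
  Horner's scheme gives every polynomial with coefficients to the right of \<open>t\<close>, and it turns proofs
  about polynomials into inductions that never mention coefficients.
\<close>

inductive_set skew_polynomials :: "('d, 'n) ring_scheme \<Rightarrow> 'd set \<Rightarrow> 'd \<Rightarrow> 'd set"
  for D E t where
  const: "a \<in> E \<Longrightarrow> a \<in> skew_polynomials D E t"
| horner: "\<lbrakk>p \<in> skew_polynomials D E t; a \<in> E\<rbrakk> \<Longrightarrow> t \<otimes>\<^bsub>D\<^esub> p \<oplus>\<^bsub>D\<^esub> a \<in> skew_polynomials D E t"

text \<open>
  The division ring \<open>L(t;\<sigma>)\<close>, described from the inside: \<open>E\<close> is the copy of \<open>L\<close>, and \<open>\<sigma>\<close> is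
  conjugation by \<open>t\<close>. The condition \<open>transcendental\<close> is the uniqueness of coefficients, stated
  for Horner's scheme.
\<close>

locale skew_fractions = ring D for D :: "('d, 'n) ring_scheme" (structure) +
  fixes E :: "'d set" and t :: 'd
  assumes units: "Units D = carrier D - {\<zero>}"
    and subfield_E: "subfield E D"
    and t_closed: "t \<in> carrier D"
    and conj_closed: "a \<in> E \<Longrightarrow> inv t \<otimes> a \<otimes> t \<in> E"
    and transcendental: "\<lbrakk>p \<in> skew_polynomials D E t; a \<in> E; t \<otimes> p \<oplus> a = \<zero>\<rbrakk> \<Longrightarrow> p = \<zero>"
    and fractions: "x \<in> carrier D \<Longrightarrow>
      \<exists>p \<in> skew_polynomials D E t. \<exists>q \<in> skew_polynomials D E t - {\<zero>}. x = p \<otimes> inv q"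
begin

abbreviation "poly \<equiv> skew_polynomials D E t"
abbreviation "s \<equiv> inv t"

definition twist :: "'d \<Rightarrow> 'd" where "twist a = s \<otimes> a \<otimes> t"

definition fixed_field :: "'d set" where "fixed_field = {a \<in> E. twist a = a}"

lemma E_sub: "a \<in> E \<Longrightarrow> a \<in> carrier D"
  using subfieldE(3)[OF subfield_E] by auto

lemma E_closed [simp, intro]:
  "\<zero> \<in> E" "\<one> \<in> E"
  "a \<in> E \<Longrightarrow> b \<in> E \<Longrightarrow> a \<oplus> b \<in> E"
  "a \<in> E \<Longrightarrow> b \<in> E \<Longrightarrow> a \<otimes> b \<in> E"
  "a \<in> E \<Longrightarrow> \<ominus> a \<in> E"
  "a \<in> E \<Longrightarrow> b \<in> E \<Longrightarrow> a \<ominus> b \<in> E"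
  using subringE[OF subfieldE(1)[OF subfield_E]] by (auto simp: minus_eq)

lemma E_comm: "a \<in> E \<Longrightarrow> b \<in> E \<Longrightarrow> a \<otimes> b = b \<otimes> a"
  using subfieldE(4)[OF subfield_E] by auto

lemma one_neq_zero: "\<one> \<noteq> \<zero>"
  using subfieldE(6)[OF subfield_E] .

lemma inverse: "a \<in> carrier D \<Longrightarrow> a \<noteq> \<zero> \<Longrightarrow> inv a \<in> carrier D"
  "a \<in> carrier D \<Longrightarrow> a \<noteq> \<zero> \<Longrightarrow> inv a \<otimes> a = \<one>"
  "a \<in> carrier D \<Longrightarrow> a \<noteq> \<zero> \<Longrightarrow> a \<otimes> inv a = \<one>"
  using units Units_l_inv Units_r_inv by auto

lemma E_inv: "a \<in> E \<Longrightarrow> a \<noteq> \<zero> \<Longrightarrow> inv a \<in> E"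
  using subfield_m_inv(1)[OF subfield_E] by auto

lemma t_nonzero: "t \<noteq> \<zero>"
proof
  assume "t = \<zero>"
  then have "t \<otimes> \<one> \<oplus> \<zero> = \<zero>" by simp
  with transcendental[of \<one> \<zero>] one_neq_zero show False
    by (auto intro: skew_polynomials.const)
qed

lemma s_closed [simp, intro]: "s \<in> carrier D"
  using inverse t_closed t_nonzero by auto

lemma t_in [simp, intro]: "t \<in> carrier D" by (rule t_closed)

lemma s_t [simp]: "s \<otimes> t = \<one>" "t \<otimes> s = \<one>"
  using inverse t_closed t_nonzero by auto

lemma s_t_cancel [simp]:
  "x \<in> carrier D \<Longrightarrow> s \<otimes> (t \<otimes> x) = x" "x \<in> carrier D \<Longrightarrow> t \<otimes> (s \<otimes> x) = x"
  using s_t by (simp_all add: m_assoc [symmetric])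

lemma twist_closed [simp, intro]: "a \<in> E \<Longrightarrow> twist a \<in> E"
  unfolding twist_def by (rule conj_closed)

lemma t_twist: "a \<in> E \<Longrightarrow> t \<otimes> twist a = a \<otimes> t"
  unfolding twist_def by (simp add: m_assoc E_sub)

lemma twist_s: "a \<in> E \<Longrightarrow> twist a \<otimes> s = s \<otimes> a"
  unfolding twist_def by (simp add: m_assoc E_sub)

lemma twist_add: "a \<in> E \<Longrightarrow> b \<in> E \<Longrightarrow> twist (a \<oplus> b) = twist a \<oplus> twist b"
  unfolding twist_def by (simp add: E_sub ring_simprules)

lemma twist_mult: "a \<in> E \<Longrightarrow> b \<in> E \<Longrightarrow> twist (a \<otimes> b) = twist a \<otimes> twist b"
  unfolding twist_def by (simp add: E_sub m_assoc)

lemma twist_one [simp]: "twist \<one> = \<one>"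
  unfolding twist_def by simp

lemma twist_zero [simp]: "twist \<zero> = \<zero>"
  unfolding twist_def by simp

text \<open>
  A list of triples \<open>(a, w, b)\<close> represents the formal sum of the tensors \<open>a \<otimes> b\<close>, each placed at the
  word \<open>w\<close>. Its value \<open>\<Sum> a (y w) b\<close> is a function of the family \<open>y\<close>. Tensors appear only through
  these values: a formal sum counts as zero if its value vanishes on every family. With a constant
  family \<open>\<lambda>_. x\<close> the words play the role of mere labels, and the list represents the operator
  \<open>x \<mapsto> \<Sum> a x b\<close>.
\<close>

fun ev :: "('d \<times> 'w \<times> 'd) list \<Rightarrow> ('w \<Rightarrow> 'd) \<Rightarrow> 'd" where
  "ev [] y = \<zero>"
| "ev ((a, w, b) # r) y = a \<otimes> y w \<otimes> b \<oplus> ev r y"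

definition terms :: "('d \<times> 'w \<times> 'd) list \<Rightarrow> bool" where
  "terms r \<longleftrightarrow> (\<forall>a w b. (a, w, b) \<in> set r \<longrightarrow> a \<in> E \<and> b \<in> E)"

definition lscale :: "'d \<Rightarrow> ('d \<times> 'w \<times> 'd) list \<Rightarrow> ('d \<times> 'w \<times> 'd) list" where
  "lscale c = map (\<lambda>(a, w, b). (c \<otimes> a, w, b))"
definition rscale :: "'d \<Rightarrow> ('d \<times> 'w \<times> 'd) list \<Rightarrow> ('d \<times> 'w \<times> 'd) list" where
  "rscale c = map (\<lambda>(a, w, b). (a, w, b \<otimes> c))"
definition ltwist :: "('d \<times> 'w \<times> 'd) list \<Rightarrow> ('d \<times> 'w \<times> 'd) list" where
  "ltwist = map (\<lambda>(a, w, b). (twist a, w, b))"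
definition rtwist :: "('d \<times> 'w \<times> 'd) list \<Rightarrow> ('d \<times> 'w \<times> 'd) list" where
  "rtwist = map (\<lambda>(a, w, b). (a, w, twist b))"

lemma terms_simps [simp]:
  "terms []"
  "terms ((a, w, b) # r) \<longleftrightarrow> a \<in> E \<and> b \<in> E \<and> terms r"
  "terms (r @ r') \<longleftrightarrow> terms r \<and> terms r'"
  by (auto simp: terms_def)

lemma terms_filter [simp, intro]: "terms r \<Longrightarrow> terms (filter P r)"
  by (auto simp: terms_def)

lemma terms_scale [simp]:
  "c \<in> E \<Longrightarrow> terms r \<Longrightarrow> terms (lscale c r)"
  "c \<in> E \<Longrightarrow> terms r \<Longrightarrow> terms (rscale c r)"
  "terms r \<Longrightarrow> terms (ltwist r)"
  "terms r \<Longrightarrow> terms (rtwist r)"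
  by (auto simp: terms_def lscale_def rscale_def ltwist_def rtwist_def)

lemma ev_closed [simp, intro]:
  "terms r \<Longrightarrow> (\<And>w. y w \<in> carrier D) \<Longrightarrow> ev r y \<in> carrier D"
  by (induction r y rule: ev.induct) (auto simp: E_sub)

lemma ev_append:
  "terms r \<Longrightarrow> terms r' \<Longrightarrow> (\<And>w. y w \<in> carrier D) \<Longrightarrow> ev (r @ r') y = ev r y \<oplus> ev r' y"
  by (induction r y rule: ev.induct) (auto simp: E_sub a_assoc)

lemma ev_lscale:
  "c \<in> E \<Longrightarrow> terms r \<Longrightarrow> (\<And>w. y w \<in> carrier D) \<Longrightarrow> ev (lscale c r) y = c \<otimes> ev r y"
  by (induction r y rule: ev.induct) (auto simp: lscale_def E_sub m_assoc r_distr)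

lemma ev_rscale:
  "c \<in> E \<Longrightarrow> terms r \<Longrightarrow> (\<And>w. y w \<in> carrier D) \<Longrightarrow> ev (rscale c r) y = ev r y \<otimes> c"
  by (induction r y rule: ev.induct) (auto simp: rscale_def E_sub m_assoc l_distr)

text \<open>
  This is the twisted linearity \<open>s (a y b) = \<sigma>(a) (s y) b\<close>, summed over the list.
\<close>

lemma ev_ltwist:
  "terms r \<Longrightarrow> (\<And>w. y w \<in> carrier D) \<Longrightarrow> ev (ltwist r) (\<lambda>w. s \<otimes> y w) = s \<otimes> ev r y"
proof (induction r y rule: ev.induct)
  case (2 a w b r y)
  then have "twist a \<otimes> (s \<otimes> y w) = s \<otimes> (a \<otimes> y w)"
    by (simp add: m_assoc [symmetric] E_sub twist_s)
  with 2 show ?case by (auto simp: ltwist_def r_distr m_assoc E_sub)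
qed (simp add: ltwist_def)

lemma ev_rtwist:
  "terms r \<Longrightarrow> (\<And>w. y w \<in> carrier D) \<Longrightarrow> ev (rtwist r) (\<lambda>w. y w \<otimes> t) = ev r y \<otimes> t"
proof (induction r y rule: ev.induct)
  case (2 a w b r y)
  then have "t \<otimes> twist b = b \<otimes> t" by (simp add: t_twist)
  with 2 show ?case by (auto simp: rtwist_def l_distr m_assoc E_sub)
qed (simp add: rtwist_def)

lemma ev_add:
  "terms r \<Longrightarrow> (\<And>w. y w \<in> carrier D) \<Longrightarrow> (\<And>w. z w \<in> carrier D) \<Longrightarrow>
    ev r (\<lambda>w. y w \<oplus> z w) = ev r y \<oplus> ev r z"
proof (induction r y rule: ev.induct)
  case (2 a w b r y)
  then show ?case by (simp add: E_sub ring_simprules)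
qed simp

lemma ev_left_linear:
  "c \<in> E \<Longrightarrow> terms r \<Longrightarrow> (\<And>w. y w \<in> carrier D) \<Longrightarrow> ev r (\<lambda>w. c \<otimes> y w) = c \<otimes> ev r y"
proof (induction r y rule: ev.induct)
  case (2 a w b r y)
  then have "a \<otimes> (c \<otimes> y w) = c \<otimes> (a \<otimes> y w)"
    using E_comm[of a c] by (simp add: m_assoc [symmetric] E_sub)
  with 2 show ?case by (auto simp: r_distr m_assoc E_sub)
qed (simp add: E_sub)

lemma ev_cong:
  "(\<And>a w b. (a, w, b) \<in> set r \<Longrightarrow> y w = z w) \<Longrightarrow> ev r y = ev r z"
  by (induction r) (auto, metis)

lemma ev_zero: "terms r \<Longrightarrow> (\<And>a w b. (a, w, b) \<in> set r \<Longrightarrow> y w = \<zero>) \<Longrightarrow> ev r y = \<zero>"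
proof (induction r)
  case (Cons e r)
  then obtain a w b where e: "e = (a, w, b)" by (cases e)
  with Cons.prems have "y w = \<zero>" "ev r y = \<zero>" by (auto intro!: Cons.IH)
  with Cons.prems e show ?case by (simp add: E_sub)
qed simp

lemma ev_one_in_E: "terms r \<Longrightarrow> ev r (\<lambda>_. \<one>) \<in> E"
  by (induction r) (auto simp: E_sub)

lemma ev_split:
  assumes "terms r" "\<And>w. y w \<in> carrier D"
  shows "ev r y = ev (filter P r) y \<oplus> ev (filter (\<lambda>x. \<not> P x) r) y"
  using assms
proof (induction r)
  case (Cons e r)
  obtain a w b where "e = (a, w, b)" by (cases e)
  with Cons show ?case by (auto simp: E_sub a_ac)
qed simp

definition coeff_at :: "'w \<Rightarrow> ('d \<times> 'w \<times> 'd) list \<Rightarrow> ('d \<times> 'w \<times> 'd) list" where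
  "coeff_at v r = filter (\<lambda>(a, w, b). w = v) r"

definition off :: "'w \<Rightarrow> ('d \<times> 'w \<times> 'd) list \<Rightarrow> ('d \<times> 'w \<times> 'd) list" where
  "off v r = filter (\<lambda>(a, w, b). w \<noteq> v) r"

lemma ev_coeff_at: "ev (coeff_at v r) y = ev (coeff_at v r) (\<lambda>_. y v)"
  by (rule ev_cong) (auto simp: coeff_at_def)

lemma ev_split_at:
  assumes "terms r" "\<And>w. y w \<in> carrier D"
  shows "ev r y = ev (coeff_at v r) (\<lambda>_. y v) \<oplus> ev (off v r) y"
proof -
  have "off v r = filter (\<lambda>x. \<not> (\<lambda>(a, w, b). w = v) x) r"
    unfolding off_def by (rule filter_cong) auto
  with ev_split[of r y "\<lambda>(a, w, b). w = v", OF assms] show ?thesis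
    by (simp add: coeff_at_def [symmetric] ev_coeff_at [of v r y, symmetric])
qed

lemma finsum_eq_ev:
  assumes "distinct ws" "\<And>w. w \<in> set ws \<Longrightarrow> a w \<in> E" "\<And>w. w \<in> set ws \<Longrightarrow> b w \<in> E" "\<And>v. y v \<in> carrier D"
  shows "(\<Oplus>w \<in> set ws. a w \<otimes> y (v w) \<otimes> b w) = ev (map (\<lambda>w. (a w, v w, b w)) ws) y"
  using assms(1-3)
proof (induction ws)
  case (Cons w ws)
  have "(\<Oplus>w \<in> insert w (set ws). a w \<otimes> y (v w) \<otimes> b w)
      = a w \<otimes> y (v w) \<otimes> b w \<oplus> (\<Oplus>w \<in> set ws. a w \<otimes> y (v w) \<otimes> b w)"
    using Cons.prems assms(4) E_sub by (intro finsum_insert) auto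
  with Cons show ?case by simp
qed simp

lemma poly_closed: "p \<in> poly \<Longrightarrow> p \<in> carrier D"
  by (induction rule: skew_polynomials.induct) (auto simp: E_sub)

text \<open>
  The effect of \<open>\<Delta> \<otimes> id\<close> on the coefficients.
\<close>

definition ldiff :: "('d \<times> 'w \<times> 'd) list \<Rightarrow> ('d \<times> 'w \<times> 'd) list" where
  "ldiff = map (\<lambda>(a, w, b). (twist a \<ominus> a, w, b))"

lemma terms_ldiff [simp]: "terms r \<Longrightarrow> terms (ldiff r)"
  by (auto simp: terms_def ldiff_def)

lemma ev_ldiff:
  "terms r \<Longrightarrow> (\<And>w. y w \<in> carrier D) \<Longrightarrow> ev (ldiff r) y = ev (ltwist r) y \<ominus> ev r y"
proof (induction r y rule: ev.induct)
  case (2 a w b r y)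
  then have c: "a \<in> carrier D" "twist a \<in> carrier D" "b \<in> carrier D" "y w \<in> carrier D"
    "ev r y \<in> carrier D" "ev (ltwist r) y \<in> carrier D"
    by (auto simp: E_sub)
  from 2 have "ev (ldiff r) y = ev (ltwist r) y \<ominus> ev r y" by simp
  with c show ?case by (simp add: ltwist_def ldiff_def ring_simprules)
qed (simp add: ltwist_def ldiff_def minus_eq)

text \<open>
  The elements of \<open>L \<otimes>\<^sub>k L\<close> that are fixed by \<open>\<sigma> \<otimes> id\<close> are those of the form \<open>1 \<otimes> b\<close>. In terms of
  operators: if the operator commutes with \<open>t\<close>, then it is linear over the skew polynomials because it
  commutes with left multiplication by \<open>E\<close> in any case, and hence it is linear over the fractions.
  So it is right multiplication by its value at \<open>\<one>\<close>.
\<close>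

lemma commuting_imp_constant:
  assumes r: "terms r" and comm: "\<And>x. x \<in> carrier D \<Longrightarrow> ev (ldiff r) (\<lambda>_. x) = \<zero>"
    and x: "x \<in> carrier D"
  shows "ev r (\<lambda>_. x) = x \<otimes> ev r (\<lambda>_. \<one>)"
proof -
  let ?\<phi> = "\<lambda>x. ev r (\<lambda>_. x)"
  have \<phi>: "?\<phi> x \<in> carrier D" if "x \<in> carrier D" for x using r that by auto
  have \<phi>_t: "?\<phi> (t \<otimes> x) = t \<otimes> ?\<phi> x" if x: "x \<in> carrier D" for x
  proof -
    have "ev (ltwist r) (\<lambda>_. x) \<ominus> ?\<phi> x = \<zero>"
      using comm[OF x] ev_ldiff[OF r, of "\<lambda>_. x"] x by simp
    then have "ev (ltwist r) (\<lambda>_. x) = ?\<phi> x"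
      using r x by simp
    moreover have "ev (ltwist r) (\<lambda>_. x) = s \<otimes> ?\<phi> (t \<otimes> x)"
      using ev_ltwist[OF r, of "\<lambda>_. t \<otimes> x"] x by simp
    ultimately have "t \<otimes> ?\<phi> x = t \<otimes> (s \<otimes> ?\<phi> (t \<otimes> x))" by simp
    then show ?thesis using \<phi>[of "t \<otimes> x"] x by simp
  qed
  have \<phi>_poly: "?\<phi> (p \<otimes> x) = p \<otimes> ?\<phi> x" if "p \<in> poly" "x \<in> carrier D" for p x
    using that
  proof (induction rule: skew_polynomials.induct)
    case (const a)
    then show ?case using ev_left_linear[OF _ r, of a "\<lambda>_. x"] by simp
  next
    case (horner p a)
    have c: "p \<in> carrier D" "a \<in> carrier D" using horner poly_closed E_sub by auto
    have "?\<phi> ((t \<otimes> p \<oplus> a) \<otimes> x) = ?\<phi> (t \<otimes> (p \<otimes> x) \<oplus> a \<otimes> x)"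
      using c horner by (simp add: l_distr m_assoc)
    also have "\<dots> = t \<otimes> (p \<otimes> ?\<phi> x) \<oplus> a \<otimes> ?\<phi> x"
      using ev_add[OF r, of "\<lambda>_. t \<otimes> (p \<otimes> x)" "\<lambda>_. a \<otimes> x"] c horner \<phi>_t[of "p \<otimes> x"]
        ev_left_linear[OF _ r, of a "\<lambda>_. x"] by simp
    also have "\<dots> = (t \<otimes> p \<oplus> a) \<otimes> ?\<phi> x"
      using c horner \<phi> by (simp add: l_distr m_assoc)
    finally show ?case .
  qed
  obtain p q where pq: "p \<in> poly" "q \<in> poly" "q \<noteq> \<zero>" "x = p \<otimes> inv q"
    using fractions[OF x] by auto
  have c: "p \<in> carrier D" "q \<in> carrier D" "inv q \<in> carrier D" "inv q \<otimes> q = \<one>" "q \<otimes> inv q = \<one>"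
    using pq poly_closed inverse by auto
  have "inv q \<otimes> (q \<otimes> ?\<phi> (inv q)) = inv q \<otimes> ?\<phi> \<one>"
    using \<phi>_poly[OF pq(2) c(3)] c by simp
  then have "?\<phi> (inv q) = inv q \<otimes> ?\<phi> \<one>"
    using c \<phi>[OF c(3)] by (simp add: m_assoc [symmetric])
  then show ?thesis using \<phi>_poly[OF pq(1) c(3)] c pq(4) \<phi> by (simp add: m_assoc)
qed

section \<open>Bimodules that are stable under the shift\<close>

definition shift_bimodule :: "'d set \<Rightarrow> bool" where
  "shift_bimodule N \<longleftrightarrow> N \<subseteq> carrier D \<and> \<zero> \<in> N \<and> (\<forall>x\<in>N. \<forall>y\<in>N. x \<oplus> y \<in> N) \<and>
     (\<forall>x\<in>N. \<forall>a\<in>E. a \<otimes> x \<in> N \<and> x \<otimes> a \<in> N) \<and> (\<forall>x\<in>N. s \<otimes> x \<in> N)"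

lemma shift_bimoduleD:
  assumes "shift_bimodule N"
  shows "x \<in> N \<Longrightarrow> x \<in> carrier D" "\<zero> \<in> N" "x \<in> N \<Longrightarrow> y \<in> N \<Longrightarrow> x \<oplus> y \<in> N"
    "x \<in> N \<Longrightarrow> y \<in> N \<Longrightarrow> x \<ominus> y \<in> N"
    "x \<in> N \<Longrightarrow> a \<in> E \<Longrightarrow> a \<otimes> x \<in> N" "x \<in> N \<Longrightarrow> a \<in> E \<Longrightarrow> x \<otimes> a \<in> N" "x \<in> N \<Longrightarrow> s \<otimes> x \<in> N"
proof -
  show sub: "x \<in> N \<Longrightarrow> x \<in> carrier D" "\<zero> \<in> N" and add: "x \<in> N \<Longrightarrow> y \<in> N \<Longrightarrow> x \<oplus> y \<in> N"
    and l: "x \<in> N \<Longrightarrow> a \<in> E \<Longrightarrow> a \<otimes> x \<in> N" "x \<in> N \<Longrightarrow> a \<in> E \<Longrightarrow> x \<otimes> a \<in> N" "x \<in> N \<Longrightarrow> s \<otimes> x \<in> N"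
    for x y a
    using assms by (auto simp: shift_bimodule_def)
  assume xy: "x \<in> N" "y \<in> N"
  have "x \<ominus> y = x \<oplus> (\<ominus> \<one>) \<otimes> y" using sub xy by (simp add: minus_eq l_minus)
  then show "x \<ominus> y \<in> N" using add l xy by simp
qed

lemma shift_bimodule_ev:
  assumes "shift_bimodule N" "terms r" "\<And>a w b. (a, w, b) \<in> set r \<Longrightarrow> y w \<in> N"
  shows "ev r y \<in> N"
  using assms(2,3)
proof (induction r)
  case (Cons e r)
  then obtain a w b where e: "e = (a, w, b)" by (cases e)
  with Cons have "y w \<in> N" "ev r y \<in> N" by (auto intro!: Cons.IH)
  with Cons.prems e show ?case using shift_bimoduleD[OF assms(1)] by simp
qed (use shift_bimoduleD[OF assms(1)] in simp)

lemma twisted_value: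
  assumes N: "shift_bimodule N" and r: "terms r" and y: "\<And>w. y w \<in> carrier D" "\<And>w. z w \<in> carrier D"
    and diff: "\<And>a w b. (a, w, b) \<in> set r \<Longrightarrow> s \<otimes> y w \<ominus> z w \<in> N"
  shows "s \<otimes> ev r y \<ominus> ev (ltwist r) z \<in> N"
proof -
  have "s \<otimes> ev r y = ev (ltwist r) (\<lambda>w. z w \<oplus> (s \<otimes> y w \<ominus> z w))"
    unfolding ev_ltwist[OF r y(1), symmetric]
    by (rule ev_cong) (use y in \<open>simp add: minus_eq a_ac r_neg r_neg2 r_neg1\<close>)
  also have "\<dots> = ev (ltwist r) z \<oplus> ev (ltwist r) (\<lambda>w. s \<otimes> y w \<ominus> z w)"
    using terms_scale(3)[OF r] y by (intro ev_add) auto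
  finally have "s \<otimes> ev r y \<ominus> ev (ltwist r) z = ev (ltwist r) (\<lambda>w. s \<otimes> y w \<ominus> z w)"
    using r y by (simp add: minus_eq a_ac r_neg r_neg2 r_neg1)
  also have "\<dots> \<in> N"
    using diff by (intro shift_bimodule_ev[OF N terms_scale(3)[OF r]]) (auto simp: ltwist_def)
  finally show ?thesis .
qed

text \<open>
  The coefficients \<open>r\<close> that send \<open>y\<close> into \<open>N\<close> form an ideal of \<open>L \<otimes>\<^sub>k L\<close>. It is stable under
  \<open>\<sigma> \<otimes> id\<close> because \<open>y\<close> is invariant under \<open>s\<close> modulo \<open>N\<close>. The proof shows that if it is
  nonzero, then it contains \<open>1\<close>. This is Artin's argument for the independence of characters: among the
  nonzero elements of the ideal take one with the fewest terms and scale its first left coefficient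
  to \<open>1\<close>. Then \<open>\<Delta> \<otimes> id\<close> kills the first term, so it kills the whole element by minimality. Hence the
  element is \<open>1 \<otimes> c\<close> with \<open>c \<noteq> 0\<close>, and \<open>c\<close> can be divided out on the right.
\<close>

lemma bimodule_simplicity:
  assumes N: "shift_bimodule N" and y: "y \<in> carrier D" "s \<otimes> y \<ominus> y \<in> N"
    and r: "terms r" "ev r (\<lambda>_. y) \<in> N" and nonzero: "x \<in> carrier D" "ev r (\<lambda>_. x) \<noteq> \<zero>"
  shows "y \<in> N"
  using r nonzero
proof (induction "length r" arbitrary: r x)
  case 0
  then show ?case by simp
next
  case (Suc n)
  note N = shift_bimoduleD[OF N]
  obtain a w b r' where r': "r = (a, w, b) # r'" "length r' = n"
    using Suc(2) by (cases r) auto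
  from r' Suc.prems have t': "a \<in> E" "b \<in> E" "terms r'" "a \<in> carrier D" "b \<in> carrier D" by (auto simp: E_sub)
  show ?case
  proof (cases "a = \<zero>")
    case True
    then have "ev r (\<lambda>_. z) = ev r' (\<lambda>_. z)" if "z \<in> carrier D" for z
      using t' that r' by simp
    with Suc.hyps(1)[of r' x] r' t' Suc.prems y show ?thesis by simp
  next
    case False
    \<comment> \<open>Scaling by \<open>inv a\<close> makes the first left coefficient \<open>\<one>\<close>, and \<open>\<Delta>(\<one>) = 0\<close>.\<close>
    define q where "q = lscale (inv a) r'"
    define r1 where "r1 = (\<one>, w, b) # q"
    have ia: "inv a \<in> E" "inv a \<in> carrier D" using E_inv t' False E_sub by auto
    have q: "terms q" "length q = n"
      using terms_scale(1)[OF ia(1) t'(3)] r' by (simp_all add: q_def lscale_def)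
    have r1_eq: "r1 = lscale (inv a) r"
      using inverse(2)[of a] t' False by (simp add: r1_def q_def r' lscale_def)
    have r1: "terms r1" using r1_eq Suc.prems ia by simp
    have r1_y: "ev r1 (\<lambda>_. y) \<in> N"
      unfolding r1_eq using ev_lscale[OF ia(1), of r "\<lambda>_. y"] N Suc.prems ia y by simp
    have "ev r1 (\<lambda>_. x) = inv a \<otimes> ev r (\<lambda>_. x)"
      unfolding r1_eq using ev_lscale[OF ia(1), of r "\<lambda>_. x"] Suc.prems by simp
    then have "a \<otimes> ev r1 (\<lambda>_. x) = ev r (\<lambda>_. x)"
      using inverse(3)[of a] t' ia False Suc.prems by (simp add: m_assoc [symmetric])
    then have r1_x: "ev r1 (\<lambda>_. x) \<noteq> \<zero>" using Suc.prems t' by auto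
    have ld: "ev (ldiff r1) (\<lambda>_. z) = ev (ldiff q) (\<lambda>_. z)" if "z \<in> carrier D" for z
    proof -
      have "ldiff r1 = (\<zero>, w, b) # ldiff q"
        by (simp add: ldiff_def r1_def minus_eq r_neg)
      then show ?thesis using that terms_ldiff[OF q(1)] t' by simp
    qed
    show ?thesis
    proof (cases "\<exists>z \<in> carrier D. ev (ldiff q) (\<lambda>_. z) \<noteq> \<zero>")
      case True
      then obtain z where z: "z \<in> carrier D" "ev (ldiff q) (\<lambda>_. z) \<noteq> \<zero>" by auto
      have "s \<otimes> ev r1 (\<lambda>_. y) \<ominus> ev (ltwist r1) (\<lambda>_. y) \<in> N"
        using twisted_value[OF assms(1) r1, of "\<lambda>_. y" "\<lambda>_. y"] y by simp
      then have "s \<otimes> ev r1 (\<lambda>_. y) \<ominus> (s \<otimes> ev r1 (\<lambda>_. y) \<ominus> ev (ltwist r1) (\<lambda>_. y)) \<in> N"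
        using N r1_y by simp
      then have "ev (ltwist r1) (\<lambda>_. y) \<in> N"
        using r1 y by (simp add: minus_eq minus_add r_neg1 r_neg2)
      then have "ev (ldiff r1) (\<lambda>_. y) \<in> N"
        using ev_ldiff[OF r1, of "\<lambda>_. y"] y N r1_y by simp
      then have "ev (ldiff q) (\<lambda>_. y) \<in> N" using ld y by simp
      moreover have "n = length (ldiff q)" using q by (simp add: ldiff_def)
      ultimately show ?thesis using Suc.hyps(1)[of "ldiff q" z] terms_ldiff[OF q(1)] z by blast
    next
      case False
      then have comm: "ev (ldiff r1) (\<lambda>_. z) = \<zero>" if "z \<in> carrier D" for z
        using ld that by auto
      define c where "c = ev r1 (\<lambda>_. \<one>)"
      have c: "c \<in> E" "c \<in> carrier D" unfolding c_def using ev_one_in_E[OF r1] E_sub by auto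
      have r1c: "ev r1 (\<lambda>_. z) = z \<otimes> c" if "z \<in> carrier D" for z
        unfolding c_def using commuting_imp_constant[OF r1 comm that] by simp
      have "c \<noteq> \<zero>" using r1_x r1c Suc.prems by auto
      then have ic: "inv c \<in> E" "inv c \<in> carrier D" "c \<otimes> inv c = \<one>" using E_inv E_sub inverse c by auto
      have "y \<otimes> c \<otimes> inv c \<in> N" using r1_y r1c y ic N by simp
      then show ?thesis using y c ic by (simp add: m_assoc)
    qed
  qed
qed

section \<open>Separating tensors by subspaces over the fixed field\<close>

definition fixed_subspace :: "'d set \<Rightarrow> bool" where
  "fixed_subspace U \<longleftrightarrow> U \<subseteq> E \<and> \<zero> \<in> U \<and> (\<forall>x\<in>U. \<forall>y\<in>U. x \<oplus> y \<in> U) \<and>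
     (\<forall>x\<in>U. \<forall>k\<in>fixed_field. k \<otimes> x \<in> U)"

lemma fixed_field_E: "k \<in> fixed_field \<Longrightarrow> k \<in> E" by (simp add: fixed_field_def)

lemma fixed_field_closed:
  "\<zero> \<in> fixed_field" "\<one> \<in> fixed_field"
  "k \<in> fixed_field \<Longrightarrow> l \<in> fixed_field \<Longrightarrow> k \<otimes> l \<in> fixed_field"
  "k \<in> fixed_field \<Longrightarrow> l \<in> fixed_field \<Longrightarrow> k \<oplus> l \<in> fixed_field"
  "k \<in> fixed_field \<Longrightarrow> \<ominus> k \<in> fixed_field"
  "k \<in> fixed_field \<Longrightarrow> k \<noteq> \<zero> \<Longrightarrow> inv k \<in> fixed_field"
proof -
  show "k \<in> fixed_field \<Longrightarrow> \<ominus> k \<in> fixed_field"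
    by (auto simp: fixed_field_def twist_def E_sub l_minus r_minus)
  show "inv k \<in> fixed_field" if k: "k \<in> fixed_field" "k \<noteq> \<zero>"
  proof -
    have kE: "k \<in> E" "twist k = k" using k by (auto simp: fixed_field_def)
    have i: "inv k \<in> E" "inv k \<in> carrier D" "k \<in> carrier D" "k \<otimes> inv k = \<one>" "inv k \<otimes> k = \<one>"
      using kE k E_inv E_sub inverse by auto
    have "k \<otimes> twist (inv k) = \<one>" using twist_mult[OF kE(1) i(1)] kE i by simp
    then have "inv k \<otimes> (k \<otimes> twist (inv k)) = inv k" using i by simp
    then have "twist (inv k) = inv k" using i E_sub[OF twist_closed[OF i(1)]] by (simp add: m_assoc [symmetric])
    then show ?thesis using i by (simp add: fixed_field_def)
  qed
qed (auto simp: fixed_field_def twist_mult twist_add)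

text \<open>
  Elements of the fixed field commute with \<open>E\<close> and with \<open>t\<close>, which generate the division ring.
\<close>

lemma fixed_field_central:
  assumes k: "k \<in> fixed_field" and x: "x \<in> carrier D"
  shows "k \<otimes> x = x \<otimes> k"
proof -
  have kE: "k \<in> E" "twist k = k" "k \<in> carrier D" using k E_sub by (auto simp: fixed_field_def)
  have "ev [(k, (), \<one>)] (\<lambda>_. x) = x \<otimes> ev [(k, (), \<one>)] (\<lambda>_. \<one>)"
    using kE by (intro commuting_imp_constant x) (auto simp: ldiff_def minus_eq r_neg)
  then show ?thesis using kE x by simp
qed

lemma fixed_subspaceD:
  assumes "fixed_subspace U"
  shows "x \<in> U \<Longrightarrow> x \<in> E" "x \<in> U \<Longrightarrow> x \<in> carrier D" "\<zero> \<in> U"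
    "x \<in> U \<Longrightarrow> y \<in> U \<Longrightarrow> x \<oplus> y \<in> U" "x \<in> U \<Longrightarrow> k \<in> fixed_field \<Longrightarrow> k \<otimes> x \<in> U"
    "x \<in> U \<Longrightarrow> k \<in> fixed_field \<Longrightarrow> x \<otimes> k \<in> U" "x \<in> U \<Longrightarrow> \<ominus> x \<in> U"
proof -
  show 1: "x \<in> U \<Longrightarrow> x \<in> E" "\<zero> \<in> U"
    "x \<in> U \<Longrightarrow> y \<in> U \<Longrightarrow> x \<oplus> y \<in> U" and k: "x \<in> U \<Longrightarrow> k \<in> fixed_field \<Longrightarrow> k \<otimes> x \<in> U" for x y k
    using assms by (auto simp: fixed_subspace_def)
  then show 2: "x \<in> U \<Longrightarrow> x \<in> carrier D" by (simp add: E_sub)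
  show "x \<in> U \<Longrightarrow> k \<in> fixed_field \<Longrightarrow> x \<otimes> k \<in> U"
    using E_comm[of x k] 1 k fixed_field_E by auto
  show "x \<in> U \<Longrightarrow> \<ominus> x \<in> U"
    using k[of x "\<ominus> \<one>"] fixed_field_closed 2 by (simp add: l_minus)
qed

lemma ev_one_in_subspace:
  assumes "fixed_subspace U" "\<And>a w b. (a, w, b) \<in> set r \<Longrightarrow> a \<in> U \<and> b \<in> fixed_field"
  shows "ev r (\<lambda>_. \<one>) \<in> U"
  using assms(2)
proof (induction r)
  case (Cons e r)
  obtain a w b where e: "e = (a, w, b)" by (cases e)
  have "ev r (\<lambda>_. \<one>) \<in> U" using Cons.prems by (intro Cons.IH) auto
  moreover have "a \<in> U" "b \<in> fixed_field" using Cons.prems[of a w b] e by auto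
  ultimately show ?case using fixed_subspaceD[OF assms(1)] e by simp
qed (simp add: fixed_subspaceD[OF assms(1)])

text \<open>
  If \<open>g \<otimes> 1\<close> cancels a tensor whose left factors lie in \<open>U\<close>, then \<open>g\<close> lies in \<open>U\<close>, as one would see by
  applying a \<open>k\<close>-linear functional with value \<open>1\<close> at \<open>1\<close> to the right factors. Since the vanishing is
  known only for the operator, the proof is by Artin's method on the right factors. If all of them lie
  in the fixed field, then evaluate at \<open>\<one>\<close>. Otherwise, conjugation by \<open>t\<close> gives a second
  relation with the same term \<open>g \<otimes> 1\<close>, and their difference can be used to eliminate one of the terms.
\<close>

lemma tensor_separation_left:
  fixes r :: "('d \<times> 'w \<times> 'd) list"
  assumes U: "fixed_subspace U" and r: "terms r" "\<And>a w b. (a, w, b) \<in> set r \<Longrightarrow> a \<in> U"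
    and g: "g \<in> E" and zero: "\<And>x. x \<in> carrier D \<Longrightarrow> g \<otimes> x \<oplus> ev r (\<lambda>_. x) = \<zero>"
  shows "g \<in> U"
  using r zero
proof (induction "length r" arbitrary: r rule: less_induct)
  case less
  note U = fixed_subspaceD[OF U]
  have gD: "g \<in> carrier D" using g E_sub by auto
  have r_x: "ev r (\<lambda>_. x) = \<ominus> (g \<otimes> x)" if "x \<in> carrier D" for x
    using less.prems(1) less.prems(3)[OF that] that gD
    by (metis ev_closed m_closed minus_equality a_comm)
  show ?case
  proof (cases "\<forall>(a, w, b) \<in> set r. b \<in> fixed_field")
    case True
    then have "ev r (\<lambda>_. \<one>) \<in> U"
      using less.prems(2) by (intro ev_one_in_subspace[OF assms(1)]) auto
    then have "\<ominus> g \<in> U" using r_x[of \<one>] gD by simp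
    then show ?thesis using U(7)[of "\<ominus> g"] gD by simp
  next
    case False
    then obtain a w b where abw: "(a, w, b) \<in> set r" "b \<notin> fixed_field" by auto
    then obtain r1 r2 where rr: "r = r1 @ (a, w, b) # r2" by (meson split_list)
    have ab: "a \<in> E" "b \<in> E" "a \<in> carrier D" "b \<in> carrier D"
      and r12: "terms r1" "terms r2" "terms (r1 @ r2)"
      using less.prems(1) rr E_sub by auto
    define e where "e = twist b \<ominus> b"
    have e: "e \<in> E" "e \<in> carrier D" "e \<noteq> \<zero>"
      using ab abw twist_closed[OF ab(2)] E_sub by (auto simp: e_def fixed_field_def)
    \<comment> \<open>The multiple of the second relation that cancels the term \<open>(a, w, b)\<close>.\<close>
    define d where "d = inv e \<otimes> b"
    have d: "d \<in> E" "d \<in> carrier D" using E_inv e ab E_sub by (auto simp: d_def)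
    have ed: "e \<otimes> d = b" using inverse(3)[of e] inverse(1)[of e] e ab by (simp add: d_def m_assoc [symmetric])
    define F where "F = map (\<lambda>(a' :: 'd, w' :: 'w, b'). (a', w', b' \<ominus> (twist b' \<ominus> b') \<otimes> d))"
    have F_terms: "terms (F r')" if "terms r'" for r'
      using that d by (auto simp: terms_def F_def)
    have F_ev: "ev (F r') (\<lambda>_. x) = ev r' (\<lambda>_. x) \<ominus> (ev (rtwist r') (\<lambda>_. x) \<ominus> ev r' (\<lambda>_. x)) \<otimes> d"
      if "terms r'" "x \<in> carrier D" for r' x
      using that(1)
    proof (induction r')
      case (Cons e' r')
      obtain a' w' b' where e': "e' = (a', w', b')" by (cases e')
      with Cons that(2) have c: "a' \<in> carrier D" "b' \<in> carrier D" "twist b' \<in> carrier D"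
        "ev (rtwist r') (\<lambda>_. x) \<in> carrier D" "ev r' (\<lambda>_. x) \<in> carrier D"
        by (auto simp: E_sub)
      from Cons e' have IH: "ev (F r') (\<lambda>_. x) = ev r' (\<lambda>_. x) \<ominus> (ev (rtwist r') (\<lambda>_. x) \<ominus> ev r' (\<lambda>_. x)) \<otimes> d"
        by simp
      have heads: "ev (F (e' # r')) (\<lambda>_. x) = a' \<otimes> x \<otimes> (b' \<ominus> (twist b' \<ominus> b') \<otimes> d) \<oplus> ev (F r') (\<lambda>_. x)"
        "ev (rtwist (e' # r')) (\<lambda>_. x) = a' \<otimes> x \<otimes> twist b' \<oplus> ev (rtwist r') (\<lambda>_. x)"
        "ev (e' # r') (\<lambda>_. x) = a' \<otimes> x \<otimes> b' \<oplus> ev r' (\<lambda>_. x)"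
        by (simp_all add: e' F_def rtwist_def)
      have "m \<otimes> (b1 \<ominus> (b2 \<ominus> b1) \<otimes> d) \<oplus> (u \<ominus> (v \<ominus> u) \<otimes> d) =
          (m \<otimes> b1 \<oplus> u) \<ominus> ((m \<otimes> b2 \<oplus> v) \<ominus> (m \<otimes> b1 \<oplus> u)) \<otimes> d"
        if "m \<in> carrier D" "b1 \<in> carrier D" "b2 \<in> carrier D" "u \<in> carrier D" "v \<in> carrier D"
        for m b1 b2 u v
        using that d(2) by (simp add: minus_eq l_distr r_distr l_minus r_minus minus_add m_assoc a_ac)
      then show ?case unfolding heads IH using c d(2) that(2) by simp
    qed (use d in \<open>simp add: F_def rtwist_def minus_eq\<close>)
    have tw: "ev (rtwist r) (\<lambda>_. x) = ev r (\<lambda>_. x)" if x: "x \<in> carrier D" for x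
    proof -
      have "ev (rtwist r) (\<lambda>_. x) = ev (rtwist r) (\<lambda>_. x \<otimes> s \<otimes> t)"
        using x by (simp add: m_assoc)
      also have "\<dots> = ev r (\<lambda>_. x \<otimes> s) \<otimes> t"
        using ev_rtwist[OF less.prems(1), of "\<lambda>_. x \<otimes> s"] x by simp
      also have "\<dots> = ev r (\<lambda>_. x)"
        using r_x[of "x \<otimes> s"] r_x[OF x] x gD by (simp add: l_minus m_assoc)
      finally show ?thesis .
    qed
    have F_r: "ev (F r) (\<lambda>_. x) = ev r (\<lambda>_. x)" if "x \<in> carrier D" for x
      using F_ev[OF less.prems(1) that] ev_closed[OF less.prems(1), of "\<lambda>_. x"] that d
      unfolding tw[OF that] by (simp add: minus_eq r_neg)
    have zz: "b \<ominus> (twist b \<ominus> b) \<otimes> d = \<zero>"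
      unfolding e_def [symmetric] ed using ab by (simp add: minus_eq r_neg)
    have "ev (F (r1 @ r2)) (\<lambda>_. x) = ev (F r) (\<lambda>_. x)" if x: "x \<in> carrier D" for x
    proof -
      have "F r = F r1 @ (a, w, \<zero>) # F r2" using zz by (simp add: rr F_def)
      moreover have "F (r1 @ r2) = F r1 @ F r2" by (simp add: F_def)
      ultimately show ?thesis using F_terms r12 x ab
        by (simp add: ev_append)
    qed
    then have "g \<otimes> x \<oplus> ev (F (r1 @ r2)) (\<lambda>_. x) = \<zero>" if "x \<in> carrier D" for x
      using F_r less.prems(3) that by simp
    moreover have "length (F (r1 @ r2)) < length r" by (simp add: F_def rr)
    moreover have "a' \<in> U" if "(a', w', b') \<in> set (F (r1 @ r2))" for a' w' b'
    proof -
      from that obtain b'' where "(a', w', b'') \<in> set r" by (auto simp: F_def rr)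
      then show ?thesis by (rule less.prems(2))
    qed
    ultimately show ?thesis by (intro less.hyps[of "F (r1 @ r2)"] F_terms[OF r12(3)])
  qed
qed

text \<open>
  In \<open>L/U \<otimes> L/V\<close> all terms of \<open>p\<close> and \<open>q\<close> vanish, so the remaining term \<open>g \<otimes> d\<close> vanishes as well, and one of
  its factors is zero there. The terms \<open>a \<otimes> b\<close> of \<open>q\<close> are removed one at a time. If \<open>g\<close> is not in
  \<open>U + k a\<close>, then this subspace can replace \<open>U\<close> and the term joins \<open>p\<close>. Otherwise \<open>a\<close> is a multiple of \<open>g\<close>
  modulo \<open>U\<close>, so the term can be merged into \<open>g \<otimes> d\<close>, which changes \<open>d\<close> by an element of \<open>V\<close>.
\<close>

lemma tensor_separation:
  fixes p q :: "('d \<times> 'w \<times> 'd) list"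
  assumes "fixed_subspace U" "fixed_subspace V" "terms p" "terms q"
    and "\<And>a w b. (a, w, b) \<in> set p \<Longrightarrow> a \<in> U" and "\<And>a w b. (a, w, b) \<in> set q \<Longrightarrow> b \<in> V"
    and "g \<in> E" "d \<in> E"
    and "\<And>x. x \<in> carrier D \<Longrightarrow> g \<otimes> x \<otimes> d \<oplus> (ev p (\<lambda>_. x) \<oplus> ev q (\<lambda>_. x)) = \<zero>"
  shows "g \<in> U \<or> d \<in> V"
  using assms
proof (induction q arbitrary: p U d)
  case Nil
  show ?case
  proof (cases "d = \<zero>")
    case True
    then show ?thesis using fixed_subspaceD[OF Nil(2)] by simp
  next
    case False
    have c: "d \<in> carrier D" "inv d \<in> carrier D" "inv d \<in> E" "d \<otimes> inv d = \<one>" "g \<in> carrier D"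
      using Nil False E_sub E_inv inverse by auto
    have "g \<otimes> x \<oplus> ev (rscale (inv d) p) (\<lambda>_. x) = \<zero>" if x: "x \<in> carrier D" for x
    proof -
      have "(g \<otimes> x \<otimes> d \<oplus> ev p (\<lambda>_. x)) \<otimes> inv d = \<zero>"
        using Nil(9)[OF x] Nil(3) x c by simp
      then show ?thesis using Nil(3) x c ev_rscale[of "inv d" p "\<lambda>_. x"]
        by (simp add: l_distr m_assoc)
    qed
    moreover have "a \<in> U" if "(a, w, b) \<in> set (rscale (inv d) p)" for a w b
    proof -
      from that obtain b' where "(a, w, b') \<in> set p" unfolding rscale_def by auto
      then show ?thesis by (rule Nil(5))
    qed
    ultimately have "g \<in> U"
      using tensor_separation_left[OF Nil(1) terms_scale(2)[OF c(3) Nil(3)] _ Nil(7)] by metis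
    then show ?thesis ..
  qed
next
  case (Cons e q)
  obtain a w b where e: "e = (a, w, b)" by (cases e)
  note U = fixed_subspaceD[OF Cons.prems(1)] and V = fixed_subspaceD[OF Cons.prems(2)]
  have ab: "a \<in> E" "b \<in> E" "b \<in> V" "terms q" using Cons.prems(4) Cons.prems(6)[of a w b] unfolding e by simp_all
  have qV: "b' \<in> V" if "(a', w', b') \<in> set q" for a' w' b'
    using Cons.prems(6)[of a' w' b'] that by simp
  have c: "a \<in> carrier D" "b \<in> carrier D" "g \<in> carrier D" "d \<in> carrier D"
    using ab Cons.prems E_sub by auto
  define U' where "U' = {u \<oplus> k \<otimes> a |u k. u \<in> U \<and> k \<in> fixed_field}"
  have U': "fixed_subspace U'"
    unfolding fixed_subspace_def
  proof (intro conjI ballI)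
    show "U' \<subseteq> E" using U ab fixed_field_E by (auto simp: U'_def)
    show "\<zero> \<in> U'" unfolding U'_def using U(3) fixed_field_closed(1) c
      by (intro CollectI exI[of _ \<zero>]) simp
  next
    fix x y assume "x \<in> U'" "y \<in> U'"
    then obtain u k v l where *: "x = u \<oplus> k \<otimes> a" "y = v \<oplus> l \<otimes> a" "u \<in> U" "v \<in> U"
      "k \<in> fixed_field" "l \<in> fixed_field" by (auto simp: U'_def)
    have cc: "u \<in> carrier D" "v \<in> carrier D" "k \<in> carrier D" "l \<in> carrier D"
      using * U E_sub fixed_field_E by auto
    have "x \<oplus> y = (u \<oplus> v) \<oplus> (k \<oplus> l) \<otimes> a" using *(1,2) c cc by (simp add: l_distr a_ac)
    then show "x \<oplus> y \<in> U'" unfolding U'_def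
      using U(4)[OF *(3,4)] fixed_field_closed(4)[OF *(5,6)] by blast
  next
    fix x k assume "x \<in> U'" "k \<in> fixed_field"
    then obtain u l where *: "x = u \<oplus> l \<otimes> a" "u \<in> U" "k \<in> fixed_field" "l \<in> fixed_field" by (auto simp: U'_def)
    have cc: "u \<in> carrier D" "k \<in> carrier D" "l \<in> carrier D"
      using * U E_sub fixed_field_E by auto
    have "k \<otimes> x = k \<otimes> u \<oplus> (k \<otimes> l) \<otimes> a" using *(1) c cc by (simp add: r_distr m_assoc)
    then show "k \<otimes> x \<in> U'" unfolding U'_def
      using U(5)[OF *(2,3)] fixed_field_closed(3)[OF *(3,4)] by blast
  qed
  have UU': "u \<in> U'" if "u \<in> U" for u
    unfolding U'_def using that fixed_field_closed(1) c U by (intro CollectI exI[of _ u] exI[of _ \<zero>]) simp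
  have aU': "a \<in> U'"
    unfolding U'_def using fixed_field_closed(2) c U by (intro CollectI exI[of _ \<zero>] exI[of _ \<one>]) simp
  show ?case
  proof (cases "g \<in> U'")
    case False
    have "g \<otimes> x \<otimes> d \<oplus> (ev ((a, w, b) # p) (\<lambda>_. x) \<oplus> ev q (\<lambda>_. x)) = \<zero>" if x: "x \<in> carrier D" for x
      using Cons.prems(9)[OF x] x ab c Cons.prems(3) e by (simp add: a_ac)
    then have "g \<in> U' \<or> d \<in> V"
      using U' Cons.prems(2-5,7,8) ab UU' aU' qV by (intro Cons.IH[of U' "(a, w, b) # p" d]) auto
    with False show ?thesis by simp
  next
    case True
    then obtain u k where uk: "g = u \<oplus> k \<otimes> a" "u \<in> U" "k \<in> fixed_field" by (auto simp: U'_def)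
    show ?thesis
    proof (cases "k = \<zero>")
      case True
      then show ?thesis using uk U c by simp
    next
      case False
      have kk: "inv k \<in> fixed_field" "inv k \<in> E" "k \<in> carrier D" "inv k \<in> carrier D" "inv k \<otimes> k = \<one>"
        "u \<in> carrier D" "u \<in> E"
        using False uk fixed_field_closed fixed_field_E E_sub inverse U by auto
      let ?p = "(\<ominus> (inv k \<otimes> u), w, b) # p" and ?d = "d \<oplus> inv k \<otimes> b"
      have a_eq: "a = inv k \<otimes> g \<oplus> \<ominus> (inv k \<otimes> u)"
      proof -
        have "inv k \<otimes> g = inv k \<otimes> u \<oplus> inv k \<otimes> k \<otimes> a"
          using uk(1) kk(3,4,6) c by (simp add: r_distr m_assoc)
        then show ?thesis using kk c by (simp add: a_ac r_neg r_neg1 r_neg2)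
      qed
      have "g \<otimes> x \<otimes> ?d \<oplus> (ev ?p (\<lambda>_. x) \<oplus> ev q (\<lambda>_. x)) = \<zero>" if x: "x \<in> carrier D" for x
      proof -
        have iv: "ev p (\<lambda>_. x) \<in> carrier D" "ev q (\<lambda>_. x) \<in> carrier D" using Cons.prems ab x by auto
        have kx: "inv k \<otimes> (g \<otimes> x) = g \<otimes> x \<otimes> inv k"
          using fixed_field_central[OF kk(1), of "g \<otimes> x"] c x by simp
        have "a \<otimes> x \<otimes> b = (inv k \<otimes> g \<oplus> \<ominus> (inv k \<otimes> u)) \<otimes> x \<otimes> b"
          using a_eq by simp
        also have "\<dots> = inv k \<otimes> (g \<otimes> x) \<otimes> b \<oplus> \<ominus> (inv k \<otimes> u) \<otimes> x \<otimes> b"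
          using kk c x by (simp add: l_distr m_assoc)
        also have "inv k \<otimes> (g \<otimes> x) \<otimes> b = g \<otimes> x \<otimes> (inv k \<otimes> b)"
          unfolding kx using kk c x by (simp add: m_assoc)
        finally have axb: "a \<otimes> x \<otimes> b = g \<otimes> x \<otimes> (inv k \<otimes> b) \<oplus> \<ominus> (inv k \<otimes> u) \<otimes> x \<otimes> b" .
        have "g \<otimes> x \<otimes> ?d \<oplus> (ev ?p (\<lambda>_. x) \<oplus> ev q (\<lambda>_. x)) =
            (g \<otimes> x \<otimes> d \<oplus> g \<otimes> x \<otimes> (inv k \<otimes> b)) \<oplus>
            ((\<ominus> (inv k \<otimes> u) \<otimes> x \<otimes> b \<oplus> ev p (\<lambda>_. x)) \<oplus> ev q (\<lambda>_. x))"
          using x c kk by (simp add: r_distr)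
        also have "\<dots> = g \<otimes> x \<otimes> d \<oplus> (ev p (\<lambda>_. x) \<oplus>
            ((g \<otimes> x \<otimes> (inv k \<otimes> b) \<oplus> \<ominus> (inv k \<otimes> u) \<otimes> x \<otimes> b) \<oplus> ev q (\<lambda>_. x)))"
          using x c kk iv by (simp add: a_ac)
        also have "\<dots> = \<zero>"
          unfolding axb [symmetric] using Cons.prems(9)[OF x] e by simp
        finally show ?thesis .
      qed
      then have "g \<in> U \<or> ?d \<in> V"
        using Cons.prems(1-5,7,8) ab U V kk qV uk by (intro Cons.IH[of U ?p ?d]) auto
      moreover have "d \<in> V" if "?d \<in> V"
      proof -
        have "?d \<oplus> \<ominus> (inv k \<otimes> b) \<in> V" using V that ab kk by simp
        then show ?thesis using c kk by (simp add: a_assoc r_neg)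
      qed
      ultimately show ?thesis by blast
    qed
  qed
qed

section \<open>Laurent polynomials and the geometric series\<close>

lemma poly_add: "p \<in> poly \<Longrightarrow> q \<in> poly \<Longrightarrow> p \<oplus> q \<in> poly"
proof (induction arbitrary: q rule: skew_polynomials.induct)
  case (const a)
  from const(2) show ?case
  proof cases
    case (horner q' b)
    then have "a \<oplus> q = t \<otimes> q' \<oplus> (a \<oplus> b)" using const E_sub poly_closed by (simp add: a_ac)
    then show ?thesis using horner const by (auto intro: skew_polynomials.horner)
  qed (use const in \<open>auto intro: skew_polynomials.const\<close>)
next
  case (horner p a)
  from horner(4) show ?case
  proof cases
    case const
    then have "t \<otimes> p \<oplus> a \<oplus> q = t \<otimes> p \<oplus> (a \<oplus> q)" using horner E_sub poly_closed by (simp add: a_ac)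
    then show ?thesis using horner const by (auto intro: skew_polynomials.horner)
  next
    case (horner q' b)
    then have "t \<otimes> p \<oplus> a \<oplus> q = t \<otimes> (p \<oplus> q') \<oplus> (a \<oplus> b)"
      using \<open>p \<in> poly\<close> \<open>a \<in> E\<close> E_sub poly_closed by (simp add: a_ac r_distr)
    then show ?thesis using horner \<open>a \<in> E\<close> \<open>\<And>q. q \<in> poly \<Longrightarrow> p \<oplus> q \<in> poly\<close>
      by (auto intro: skew_polynomials.horner)
  qed
qed

lemma poly_E: "a \<in> E \<Longrightarrow> a \<in> poly" by (rule skew_polynomials.const)

lemma poly_t: "p \<in> poly \<Longrightarrow> t \<otimes> p \<in> poly"
  using skew_polynomials.horner[of p D E t \<zero>] poly_closed by simp

lemma poly_lmult: "p \<in> poly \<Longrightarrow> a \<in> E \<Longrightarrow> a \<otimes> p \<in> poly"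
proof (induction arbitrary: a rule: skew_polynomials.induct)
  case (horner p b)
  then have c: "p \<in> carrier D" "a \<in> carrier D" "b \<in> carrier D" "twist a \<in> carrier D"
    using poly_closed E_sub by auto
  have "a \<otimes> (t \<otimes> p \<oplus> b) = t \<otimes> (twist a \<otimes> p) \<oplus> a \<otimes> b"
    using c t_twist[OF horner(4)] by (simp add: r_distr m_assoc [symmetric])
  then show ?case using horner by (auto intro: skew_polynomials.horner)
qed (auto intro: poly_E)

lemma poly_rmult: "p \<in> poly \<Longrightarrow> a \<in> E \<Longrightarrow> p \<otimes> a \<in> poly"
proof (induction rule: skew_polynomials.induct)
  case (horner p b)
  then have "(t \<otimes> p \<oplus> b) \<otimes> a = t \<otimes> (p \<otimes> a) \<oplus> b \<otimes> a"
    using E_sub poly_closed by (simp add: l_distr m_assoc)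
  then show ?case using horner by (auto intro: skew_polynomials.horner)
qed (auto intro: poly_E)

lemma poly_rmult_t: "p \<in> poly \<Longrightarrow> p \<otimes> t \<in> poly"
proof (induction rule: skew_polynomials.induct)
  case (const a)
  then show ?case using t_twist[of a] poly_t[OF poly_E] twist_closed by metis
next
  case (horner p b)
  then have "(t \<otimes> p \<oplus> b) \<otimes> t = t \<otimes> (p \<otimes> t \<oplus> twist b)"
    using E_sub poly_closed t_twist[of b] by (simp add: l_distr r_distr m_assoc)
  then show ?case using horner poly_t[OF poly_add[OF horner.IH poly_E[OF twist_closed]]] by simp
qed

lemma poly_rmult_t_pow: "p \<in> poly \<Longrightarrow> p \<otimes> t [^] (n::nat) \<in> poly"
proof (induction n)
  case (Suc n)
  then have "p \<otimes> t [^] Suc n = p \<otimes> t [^] n \<otimes> t" using poly_closed by (simp add: m_assoc)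
  then show ?case using Suc poly_rmult_t by simp
qed (simp add: poly_closed)

lemma poly_conj: "p \<in> poly \<Longrightarrow> s \<otimes> p \<otimes> t \<in> poly"
proof (induction rule: skew_polynomials.cases)
  case (const a)
  then show ?case using twist_closed poly_E unfolding twist_def by blast
next
  case (horner p' b)
  then have "s \<otimes> p \<otimes> t = p' \<otimes> t \<oplus> twist b"
    using E_sub poly_closed by (simp add: l_distr r_distr m_assoc twist_def)
  then show ?case using poly_add[OF poly_rmult_t[OF horner(2)] poly_E[OF twist_closed[OF horner(3)]]] by metis
qed

lemma horner_inject:
  assumes "p \<in> poly" "q \<in> poly" "a \<in> E" "b \<in> E" "t \<otimes> p \<oplus> a = t \<otimes> q \<oplus> b"
  shows "p = q" "a = b"
proof -
  have c: "p \<in> carrier D" "q \<in> carrier D" "a \<in> carrier D" "b \<in> carrier D"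
    using assms poly_closed E_sub by auto
  have neg: "p \<oplus> \<ominus> \<one> \<otimes> q \<in> poly" using assms by (auto intro!: poly_add poly_lmult)
  have "t \<otimes> (p \<oplus> \<ominus> \<one> \<otimes> q) \<oplus> (a \<ominus> b) = (t \<otimes> p \<oplus> a) \<ominus> (t \<otimes> q \<oplus> b)"
    using c by (simp add: minus_eq r_distr l_minus r_minus minus_add a_ac)
  also have "\<dots> = \<zero>" using c assms(5) by (simp add: minus_eq r_neg)
  finally have "p \<oplus> \<ominus> \<one> \<otimes> q = \<zero>" using transcendental[OF neg, of "a \<ominus> b"] assms(3,4) by blast
  then show "p = q" using c by (simp add: l_minus minus_eq [symmetric])
  then show "a = b" using assms(5) c by simp
qed

text \<open>
  A solution \<open>p\<close> would be the geometric series \<open>t\<^sup>n + t\<^sup>n\<^sup>+\<^sup>1 + \<dots>\<close>, which is not a polynomial. For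
  \<open>n > 0\<close> the constant coefficient of \<open>p\<close> is zero, and cancelling \<open>t\<close> lowers \<open>n\<close>. For \<open>n = 0\<close> the
  constant coefficient is \<open>1\<close>, and removing it from \<open>p\<close> leaves \<open>t\<close> times another solution, of lower degree.
\<close>

lemma no_geometric_series:
  assumes "p \<in> poly" "p = t \<otimes> p \<oplus> t [^] (n::nat)"
  shows False
  using assms
proof (induction n arbitrary: p)
  case 0
  then show ?case
  proof (induction rule: skew_polynomials.induct)
    case (const a)
    have a: "t \<otimes> \<zero> \<oplus> a = a" using E_sub[OF const(1)] by simp
    have "t \<otimes> \<zero> \<oplus> a = t \<otimes> a \<oplus> \<one>" unfolding a by (rule const(2)[unfolded nat_pow_0])
    note horner_inject[OF poly_E[OF E_closed(1)] poly_E[OF const(1)] const(1) E_closed(2) this]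
    with one_neq_zero show ?case by metis
  next
    case (horner p a)
    note horner_inject(1)[OF horner(1) skew_polynomials.horner[OF horner(1,2)] horner(2) E_closed(2)
        horner(4)[unfolded nat_pow_0]]
      horner_inject(2)[OF horner(1) skew_polynomials.horner[OF horner(1,2)] horner(2) E_closed(2)
        horner(4)[unfolded nat_pow_0]]
    then have "p = t \<otimes> p \<oplus> t [^] (0::nat)" unfolding nat_pow_0 by metis
    then show ?case by (rule horner.IH)
  qed
next
  case (Suc n)
  have "\<exists>p' \<in> poly. \<exists>a \<in> E. p = t \<otimes> p' \<oplus> a"
    using \<open>p \<in> poly\<close>
  proof cases
    case const
    then have "p = t \<otimes> \<zero> \<oplus> p" using E_sub by simp
    then show ?thesis using poly_E[OF E_closed(1)] const by blast
  qed blast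
  then obtain p' a where p': "p' \<in> poly" "a \<in> E" "p = t \<otimes> p' \<oplus> a" by blast
  have tn: "t [^] n \<in> poly" using poly_rmult_t_pow[OF poly_E[OF E_closed(2)], of n] by simp
  have c: "p \<in> carrier D" "p' \<in> carrier D" using Suc.prems(1) p' poly_closed by auto
  have "t \<otimes> p' \<oplus> a = t \<otimes> p \<oplus> t [^] Suc n"
    unfolding p'(3) [symmetric] by (rule Suc.prems(2))
  also have "\<dots> = t \<otimes> (p \<oplus> t [^] n) \<oplus> \<zero>"
    unfolding nat_pow_Suc2[OF t_in] using c by (simp add: r_distr)
  finally have eq: "p' = p \<oplus> t [^] n" "a = \<zero>"
    using horner_inject[OF p'(1) poly_add[OF Suc.prems(1) tn] p'(2) E_closed(1)] by blast+
  have "p = t \<otimes> p'" unfolding p'(3) eq(2) using c by simp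
  then have "p' = t \<otimes> p' \<oplus> t [^] n" using eq(1) by metis
  then show ?case by (rule Suc.IH[OF p'(1)])
qed

text \<open>
  The Laurent polynomials in \<open>t\<close>. Powers of \<open>t\<close> move from one side to the other at the cost of twisting
  coefficients. Clearing denominators on the right makes stability under left multiplication by \<open>s\<close> a
  statement about conjugation of polynomials by \<open>t\<close>, which is \<open>poly_conj\<close>.
\<close>

definition laurent :: "'d set" where
  "laurent = {x \<in> carrier D. \<exists>n::nat. x \<otimes> t [^] n \<in> poly}"

lemma E_t_pow: "b \<in> E \<Longrightarrow> \<exists>b' \<in> E. b \<otimes> t [^] (n::nat) = t [^] n \<otimes> b'"
proof (induction n)
  case 0
  then show ?case using E_sub by auto
next
  case (Suc n)
  then obtain b' where b': "b' \<in> E" "b \<otimes> t [^] n = t [^] n \<otimes> b'" by auto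
  note c = E_sub[OF b'(1)] E_sub[OF Suc.prems] E_sub[OF twist_closed[OF b'(1)]]
  have "b \<otimes> t [^] Suc n = (b \<otimes> t [^] n) \<otimes> t" using c by (simp add: m_assoc)
  also have "\<dots> = t [^] n \<otimes> (b' \<otimes> t)" unfolding b'(2) using c by (simp add: m_assoc)
  also have "\<dots> = t [^] Suc n \<otimes> twist b'"
    unfolding t_twist[OF b'(1), symmetric] using c by (simp add: m_assoc)
  finally show ?case using b'(1) by blast
qed

lemma shift_bimodule_laurent: "shift_bimodule laurent"
  unfolding shift_bimodule_def
proof (intro conjI ballI)
  show "laurent \<subseteq> carrier D" by (auto simp: laurent_def)
  show "\<zero> \<in> laurent" by (auto simp: laurent_def intro!: exI[of _ "0::nat"] poly_E)
next
  fix x y assume "x \<in> laurent" "y \<in> laurent"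
  then obtain n m :: nat where *: "x \<in> carrier D" "y \<in> carrier D" "x \<otimes> t [^] n \<in> poly" "y \<otimes> t [^] m \<in> poly"
    by (auto simp: laurent_def)
  have "(x \<oplus> y) \<otimes> t [^] (n + m) = x \<otimes> t [^] n \<otimes> t [^] m \<oplus> y \<otimes> t [^] m \<otimes> t [^] n"
    using *(1,2) by (simp add: l_distr m_assoc nat_pow_mult add.commute)
  also have "\<dots> \<in> poly" by (rule poly_add[OF poly_rmult_t_pow[OF *(3)] poly_rmult_t_pow[OF *(4)]])
  finally show "x \<oplus> y \<in> laurent" using * by (auto simp: laurent_def)
next
  fix x a assume "x \<in> laurent" and a: "a \<in> E"
  then obtain n :: nat where *: "x \<in> carrier D" "x \<otimes> t [^] n \<in> poly"
    by (auto simp: laurent_def)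
  have aD: "a \<in> carrier D" using a E_sub by auto
  have "a \<otimes> x \<otimes> t [^] n \<in> poly" using poly_lmult[OF *(2) a] * aD by (simp add: m_assoc)
  then show "a \<otimes> x \<in> laurent" using * aD by (auto simp: laurent_def)
  obtain a' where a': "a' \<in> E" "a \<otimes> t [^] n = t [^] n \<otimes> a'" using E_t_pow[OF a] by blast
  have "x \<otimes> a \<otimes> t [^] n = x \<otimes> (a \<otimes> t [^] n)" using aD *(1) by (simp add: m_assoc)
  also have "\<dots> = x \<otimes> t [^] n \<otimes> a'" unfolding a'(2) using E_sub[OF a'(1)] *(1) by (simp add: m_assoc)
  finally have "x \<otimes> a \<otimes> t [^] n = x \<otimes> t [^] n \<otimes> a'" .
  then have "x \<otimes> a \<otimes> t [^] n \<in> poly" using poly_rmult[OF *(2) a'(1)] by simp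
  then show "x \<otimes> a \<in> laurent" using * aD by (auto simp: laurent_def)
next
  fix x assume "x \<in> laurent"
  then obtain n :: nat where *: "x \<in> carrier D" "x \<otimes> t [^] n \<in> poly"
    by (auto simp: laurent_def)
  have "s \<otimes> x \<otimes> t [^] Suc n = s \<otimes> (x \<otimes> t [^] n) \<otimes> t" using * by (simp add: m_assoc)
  then have "s \<otimes> x \<otimes> t [^] Suc n \<in> poly" using poly_conj[OF *(2)] by simp
  then show "s \<otimes> x \<in> laurent" unfolding laurent_def using * by blast
qed

lemma E_laurent: "a \<in> E \<Longrightarrow> a \<in> laurent"
  unfolding laurent_def using E_sub poly_E[of a] by (auto intro!: exI[of _ "0::nat"])

definition u :: "'d" where "u = t \<otimes> inv (\<one> \<ominus> t)"

lemma one_minus_t: "\<one> \<ominus> t \<in> carrier D" "\<one> \<ominus> t \<noteq> \<zero>"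
proof -
  show "\<one> \<ominus> t \<in> carrier D" by simp
  show "\<one> \<ominus> t \<noteq> \<zero>"
  proof
    assume "\<one> \<ominus> t = \<zero>"
    then have t1: "t = \<one>" using t_in by (metis one_closed r_right_minus_eq)
    have "t \<otimes> \<one> \<oplus> \<zero> = t \<otimes> \<zero> \<oplus> \<one>" unfolding t1 by simp
    from horner_inject(2)[OF _ _ _ _ this] one_neq_zero show False by (auto intro: poly_E)
  qed
qed

lemma u_closed [simp, intro]: "u \<in> carrier D"
  unfolding u_def using one_minus_t inverse(1) by auto

lemma s_u: "s \<otimes> u = u \<oplus> \<one>"
proof -
  let ?w = "inv (\<one> \<ominus> t)"
  have w: "?w \<in> carrier D" "(\<one> \<ominus> t) \<otimes> ?w = \<one>" using one_minus_t inverse by auto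
  have "?w = (\<one> \<ominus> t) \<otimes> ?w \<oplus> t \<otimes> ?w"
    using w(1) by (simp add: minus_eq l_distr l_minus a_assoc l_neg)
  then have "?w = \<one> \<oplus> u" using w(2) by (simp add: u_def)
  then show ?thesis using w(1) by (simp add: u_def a_comm)
qed

lemma u_not_laurent: "u \<notin> laurent"
proof
  assume "u \<in> laurent"
  then obtain n :: nat where n: "u \<otimes> t [^] n \<in> poly" by (auto simp: laurent_def)
  have "u = t \<otimes> (s \<otimes> u)" by simp
  also have "\<dots> = t \<otimes> u \<oplus> t" unfolding s_u by (simp add: r_distr)
  finally have "u \<otimes> t [^] n = (t \<otimes> u \<oplus> t) \<otimes> t [^] n" by simp
  also have "\<dots> = t \<otimes> (u \<otimes> t [^] n) \<oplus> t [^] Suc n"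
    unfolding nat_pow_Suc2[OF t_in] by (simp add: l_distr m_assoc)
  finally show False by (rule no_geometric_series[OF n])
qed

end

section \<open>Independence of the iterated products\<close>

text \<open>
  The subspace \<open>U\<close> for a positive \<open>i\<close> witnesses that \<open>f\<^sup>i\<close> is not a combination of other powers of \<open>f\<close>
  modulo \<open>\<Delta>(E)\<close>. For \<open>i = 0\<close> the differences cannot be included, because \<open>1\<close> may be one.
\<close>

locale separated_powers = skew_fractions D E t for D :: "('d, 'n) ring_scheme" (structure) and E t +
  fixes f :: 'd
  assumes f_E: "f \<in> E"
    and separated: "\<exists>U. fixed_subspace U \<and> (\<forall>j::nat. j \<noteq> i \<longrightarrow> f [^] j \<in> U) \<and> f [^] i \<notin> U \<and>
      (0 < i \<longrightarrow> (\<forall>a \<in> E. twist a \<ominus> a \<in> U))"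
begin

lemma f_pow_E [simp, intro]: "f [^] (n::nat) \<in> E"
  by (induction n) (auto simp: f_E)

lemma f_pow_closed [simp, intro]: "f [^] (n::nat) \<in> carrier D"
  using E_sub by auto

text \<open>
  The analogue of an iterated integral, with \<open>u\<close> in the place of integration.
\<close>

fun Y :: "nat list \<Rightarrow> 'd" where
  "Y [] = u"
| "Y (i # v) = u \<otimes> (f [^] i \<otimes> Y v)"

lemma Y_closed [simp, intro]: "Y v \<in> carrier D"
  by (induction v) auto

text \<open>
  \<open>peel\<close> describes how \<open>s - 1\<close> acts on the family \<open>Y\<close> modulo Laurent polynomials: it removes the first
  letter. The adjoint operation on formal sums is \<open>peeled\<close>, which moves the power of \<open>f\<close> from the
  family into the coefficients.
\<close>

definition peel :: "(nat list \<Rightarrow> 'd) \<Rightarrow> nat list \<Rightarrow> 'd" where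
  "peel y w = (case w of [] \<Rightarrow> \<zero> | i # v \<Rightarrow> f [^] i \<otimes> y v)"

definition peeled :: "('d \<times> nat list \<times> 'd) list \<Rightarrow> ('d \<times> nat list \<times> 'd) list" where
  "peeled r = concat (map (\<lambda>(a, w, b). case w of [] \<Rightarrow> [] | i # v \<Rightarrow> [(a \<otimes> f [^] i, v, b)]) r)"

lemma peel_closed [simp, intro]: "(\<And>w. y w \<in> carrier D) \<Longrightarrow> peel y w \<in> carrier D"
  by (auto simp: peel_def split: list.split)

lemma peeled_Nil [simp]: "peeled [] = []"
  and peeled_Cons [simp]: "peeled ((a, [], b) # r) = peeled r"
    "peeled ((a, i # v, b) # r) = (a \<otimes> f [^] i, v, b) # peeled r"
  by (simp_all add: peeled_def)

lemma terms_peeled [simp, intro]: "terms r \<Longrightarrow> terms (peeled r)"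
proof (induction r)
  case (Cons e r)
  obtain a w b where "e = (a, w, b)" by (cases e)
  with Cons show ?case by (cases w) auto
qed simp

lemma ev_peeled:
  assumes "terms r" "\<And>w. y w \<in> carrier D"
  shows "ev (peeled r) y = ev r (peel y)"
  using assms(1)
proof (induction r)
  case (Cons e r)
  obtain a w b where "e = (a, w, b)" by (cases e)
  moreover have "ev (peeled r) y = ev r (peel y)" using Cons by (cases e) auto
  moreover have "ev r (peel y) \<in> carrier D" using Cons.prems assms(2) by (cases e) auto
  ultimately show ?case using Cons.prems assms(2)
    by (cases w) (auto simp: peel_def [of y "_ # _"] peel_def [of y "[]"] m_assoc E_sub)
qed simp

definition words_of :: "('d \<times> 'w \<times> 'd) list \<Rightarrow> 'w set" where
  "words_of r = (\<lambda>(a, w, b). w) ` set r"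

lemma words_of_iff: "w \<in> words_of r \<longleftrightarrow> (\<exists>a b. (a, w, b) \<in> set r)"
  by (force simp: words_of_def)

lemma words_of_simps [simp]:
  "words_of [] = {}" "words_of ((a, w, b) # r) = insert w (words_of r)"
  "words_of (r @ r') = words_of r \<union> words_of r'" "words_of (lscale c r) = words_of r"
  "words_of (rscale c r) = words_of r"
  "words_of (ltwist r) = words_of r" "words_of (ldiff r) = words_of r"
  by (auto simp: words_of_def lscale_def rscale_def ltwist_def ldiff_def image_image case_prod_unfold)

lemma words_of_peeled: "v \<in> words_of (peeled r) \<longleftrightarrow> (\<exists>i. i # v \<in> words_of r)"
proof (induction r)
  case (Cons e r)
  obtain a w b where "e = (a, w, b)" by (cases e)
  with Cons show ?case by (cases w) auto
qed simp

lemma words_of_off: "words_of (off v r) = words_of r - {v}"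
  by (force simp: words_of_def off_def)

lemma terms_parts [simp, intro]: "terms r \<Longrightarrow> terms (coeff_at v r)" "terms r \<Longrightarrow> terms (off v r)"
  by (simp_all add: coeff_at_def off_def)

lemma coeff_at_ltwist: "coeff_at v (ltwist r) = ltwist (coeff_at v r)"
  by (induction r) (auto simp: coeff_at_def ltwist_def)

lemma coeff_at_eq_Nil: "v \<notin> words_of r \<Longrightarrow> coeff_at v r = []"
  by (force simp: words_of_def coeff_at_def filter_empty_conv)

lemma ev_single:
  assumes "terms r" "x \<in> carrier D"
  shows "ev r (\<lambda>w. if w = v then x else \<zero>) = ev (coeff_at v r) (\<lambda>_. x)"
proof -
  have "ev (off v r) (\<lambda>w. if w = v then x else \<zero>) = \<zero>"
    using assms by (intro ev_zero) (auto simp: off_def)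
  with ev_split_at[OF assms(1), of "\<lambda>w. if w = v then x else \<zero>" v] assms show ?thesis by auto
qed

text \<open>
  Collects, word by word, a formal sum whose coefficients act on the relevant elements by multiplication
  with \<open>g z\<close> on the left and \<open>c z\<close> on the right.
\<close>

lemma ev_by_coefficients:
  assumes "distinct zs" "terms r" "x \<in> carrier D" "\<And>w. h w \<in> carrier D"
    and "\<And>w. w \<in> words_of r \<Longrightarrow> w \<notin> set zs \<Longrightarrow> h w = \<zero>"
    and "\<And>z. z \<in> set zs \<Longrightarrow> ev (coeff_at z r) (\<lambda>_. h z) = g z \<otimes> x \<otimes> c z"
  shows "ev r h = ev (map (\<lambda>z. (g z, z, c z)) zs) (\<lambda>_. x)"
  using assms
proof (induction zs arbitrary: r)
  case Nil
  then show ?case by (intro trans[OF ev_zero]) (auto simp: words_of_iff)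
next
  case (Cons z zs)
  have "ev (off z r) h = ev (map (\<lambda>z. (g z, z, c z)) zs) (\<lambda>_. x)"
  proof (rule Cons.IH)
    fix w assume w: "w \<in> set zs"
    then have "w \<noteq> z" using Cons.prems(1) by auto
    then have "coeff_at w (off z r) = coeff_at w r"
      by (auto simp: coeff_at_def off_def intro!: filter_cong)
    then show "ev (coeff_at w (off z r)) (\<lambda>_. h w) = g w \<otimes> x \<otimes> c w" using Cons.prems(6) w by simp
  qed (use Cons.prems in \<open>auto simp: words_of_off\<close>)
  moreover have "ev (coeff_at z r) (\<lambda>_. h z) = g z \<otimes> x \<otimes> c z" using Cons.prems(6) by simp
  ultimately show ?case using ev_split_at[of r h z] Cons.prems(2,4) by simp
qed

lemma s_Y: "s \<otimes> Y w \<ominus> (Y w \<oplus> peel Y w) \<in> laurent"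
proof (cases w)
  case Nil
  have "s \<otimes> Y w \<ominus> (Y w \<oplus> peel Y w) = \<one>"
    unfolding Nil peel_def by (simp add: s_u minus_eq a_ac r_neg r_neg1 r_neg2)
  then show ?thesis using E_laurent by simp
next
  case (Cons i v)
  have "s \<otimes> Y w = (s \<otimes> u) \<otimes> (f [^] i \<otimes> Y v)" unfolding Cons by (simp add: m_assoc)
  also have "\<dots> = Y w \<oplus> peel Y w" unfolding s_u Cons peel_def by (simp add: l_distr)
  finally show ?thesis using shift_bimoduleD(2)[OF shift_bimodule_laurent]
    by (simp add: minus_eq r_neg)
qed

lemma shifted_relation:
  assumes "terms r"
  shows "s \<otimes> ev r Y \<ominus> (ev (ltwist r) Y \<oplus> ev (peeled (ltwist r)) Y) \<in> laurent"
proof -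
  have "ev (ltwist r) (\<lambda>w. Y w \<oplus> peel Y w) = ev (ltwist r) Y \<oplus> ev (ltwist r) (peel Y)"
    using assms by (intro ev_add) auto
  then show ?thesis
    using twisted_value[OF shift_bimodule_laurent assms, of Y "\<lambda>w. Y w \<oplus> peel Y w"] s_Y assms
    by (simp add: ev_peeled)
qed

definition span_mod_laurent :: "nat list set \<Rightarrow> 'd set" where
  "span_mod_laurent V = {ev r Y \<oplus> m | r m. terms r \<and> words_of r \<subseteq> V \<and> m \<in> laurent}"

lemma laurent_remainder:
  assumes "x \<ominus> y \<in> laurent" "x \<in> carrier D" "y \<in> carrier D"
  obtains m where "m \<in> laurent" "x = y \<oplus> m"
proof
  show "x = y \<oplus> (x \<ominus> y)" using assms by (simp add: minus_eq a_ac r_neg r_neg1 r_neg2)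
qed (rule assms)

text \<open>
  Since \<open>s\<close> removes first letters, sets of words that are closed under tails give spans that are stable
  under \<open>s\<close>.
\<close>

lemma shift_bimodule_span:
  assumes tail_closed: "\<And>i v. i # v \<in> V \<Longrightarrow> v \<in> V"
  shows "shift_bimodule (span_mod_laurent V)"
  unfolding shift_bimodule_def
proof (intro conjI ballI)
  note M = shift_bimoduleD[OF shift_bimodule_laurent]
  show "span_mod_laurent V \<subseteq> carrier D" using M by (auto simp: span_mod_laurent_def)
  show "\<zero> \<in> span_mod_laurent V"
    unfolding span_mod_laurent_def using M(2) by (intro CollectI exI[of _ "[]"] exI[of _ \<zero>]) simp
  have intro: "x \<in> span_mod_laurent V"
    if "x = ev r Y \<oplus> m" "terms r" "words_of r \<subseteq> V" "m \<in> laurent" for x r m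
    using that unfolding span_mod_laurent_def by blast
  {
    fix x y assume "x \<in> span_mod_laurent V" "y \<in> span_mod_laurent V"
    then obtain r m r' m' where *: "x = ev r Y \<oplus> m" "terms r" "words_of r \<subseteq> V" "m \<in> laurent"
      "y = ev r' Y \<oplus> m'" "terms r'" "words_of r' \<subseteq> V" "m' \<in> laurent"
      by (auto simp: span_mod_laurent_def)
    have "x \<oplus> y = ev (r @ r') Y \<oplus> (m \<oplus> m')"
      using * M(1) by (simp add: ev_append a_ac)
    from intro[OF this] show "x \<oplus> y \<in> span_mod_laurent V" using * M by auto
  }
  {
    fix x a assume "x \<in> span_mod_laurent V" "a \<in> E"
    then obtain r m where *: "x = ev r Y \<oplus> m" "terms r" "words_of r \<subseteq> V" "m \<in> laurent" "a \<in> E" "a \<in> carrier D"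
      using E_sub by (auto simp: span_mod_laurent_def)
    have "a \<otimes> x = ev (lscale a r) Y \<oplus> a \<otimes> m"
      using * M(1) by (simp add: ev_lscale r_distr)
    from intro[OF this] show "a \<otimes> x \<in> span_mod_laurent V" using * M by auto
    have "x \<otimes> a = ev (rscale a r) Y \<oplus> m \<otimes> a"
      using * M(1) by (simp add: ev_rscale l_distr)
    from intro[OF this] show "x \<otimes> a \<in> span_mod_laurent V" using * M by auto
  }
  {
    fix x assume "x \<in> span_mod_laurent V"
    then obtain r m where *: "x = ev r Y \<oplus> m" "terms r" "words_of r \<subseteq> V" "m \<in> laurent"
      by (auto simp: span_mod_laurent_def)
    let ?r = "ltwist r @ peeled (ltwist r)"
    have terms: "terms ?r" using * by simp
    have "v \<in> V" if "i # v \<in> words_of r" for i v using that *(3) tail_closed by blast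
    then have supp: "words_of ?r \<subseteq> V" using *(3) by (auto simp: words_of_peeled)
    obtain n where n: "n \<in> laurent" "s \<otimes> ev r Y = ev ?r Y \<oplus> n"
      using laurent_remainder[OF shifted_relation[OF *(2)]] terms * by (auto simp: ev_append)
    have "s \<otimes> x = ev ?r Y \<oplus> (n \<oplus> s \<otimes> m)"
      using n * M(1) terms by (simp add: r_distr a_assoc del: words_of_simps terms_simps)
    from intro[OF this terms supp] show "s \<otimes> x \<in> span_mod_laurent V" using n(1) *(4) M by auto
  }
qed

text \<open>
  The heart of the argument. Let \<open>w0 = j # v\<close>. If \<open>Y w0\<close> were in the span of the other words, there would
  be a relation \<open>r\<close> with coefficient \<open>1\<close> at \<open>w0\<close>. Applying \<open>s - 1\<close> gives a relation \<open>e\<close> between the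
  other words, since \<open>\<Delta>(1) = 0\<close> and no word of \<open>W\<close> is longer than \<open>w0\<close>. By \<open>IH\<close> all coefficients of
  \<open>e\<close> vanish. At a word \<open>z\<close> of maximal length this says that the coefficient of \<open>r\<close> is a constant
  \<open>1 \<otimes> c z\<close>. At the word \<open>v\<close> it says that \<open>\<Sum> f\<^sup>i \<otimes> c (i # v)\<close>, in which \<open>f\<^sup>j\<close> has coefficient \<open>1\<close>, lies
  in the image of \<open>\<Delta> \<otimes> id\<close>. By \<open>tensor_separation_left\<close> this contradicts \<open>separated\<close>.
  If \<open>w0\<close> is empty, then there are no other words, and \<open>u\<close> itself would be a Laurent polynomial.
\<close>

lemma top_word_independent:
  assumes pos: "\<And>w. w \<in> W \<Longrightarrow> 0 \<notin> set w" and fin: "finite W"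
    and tail_closed: "\<And>i v. i # v \<in> W \<Longrightarrow> v \<in> W"
    and top: "w0 \<in> W" "\<And>w. w \<in> W \<Longrightarrow> length w \<le> length w0"
    and IH: "\<And>r y. \<lbrakk>terms r; words_of r \<subseteq> W - {w0}; ev r Y \<in> laurent; \<And>w. y w \<in> carrier D\<rbrakk> \<Longrightarrow> ev r y = \<zero>"
  shows "Y w0 \<notin> span_mod_laurent (W - {w0})"
proof
  note M = shift_bimoduleD[OF shift_bimodule_laurent]
  assume "Y w0 \<in> span_mod_laurent (W - {w0})"
  then obtain q m where q: "Y w0 = ev q Y \<oplus> m" "terms q" "words_of q \<subseteq> W - {w0}" "m \<in> laurent"
    unfolding span_mod_laurent_def by blast
  define p where "p = lscale (\<ominus> \<one>) q"
  have p: "terms p" "words_of p \<subseteq> W - {w0}" unfolding p_def using q by auto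
  have p_ev: "ev p Y = \<ominus> ev q Y" unfolding p_def using q by (simp add: ev_lscale l_minus)
  define r where "r = (\<one>, w0, \<one>) # p"
  have r: "terms r" "words_of r \<subseteq> W" using p top(1) by (auto simp: r_def)
  have "ev r Y = m" unfolding r_def using p_ev q M(1) by (simp add: q(1) a_ac r_neg r_neg1 r_neg2)
  then have rY: "ev r Y \<in> laurent" using q by simp
  have tr: "terms (ltwist r)" "terms (peeled (ltwist r))" using r by auto
  have peel_supp: "words_of (peeled (ltwist r)) \<subseteq> W - {w0}"
  proof
    fix v assume "v \<in> words_of (peeled (ltwist r))"
    then obtain i where "i # v \<in> W" using r by (auto simp: words_of_peeled)
    then show "v \<in> W - {w0}" using tail_closed top(2)[of "i # v"] by auto
  qed
  define e where "e = ldiff p @ peeled (ltwist r)"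
  have e: "terms e" "words_of e \<subseteq> W - {w0}" unfolding e_def using p tr peel_supp by auto
  have e_ev: "ev e y = (ev (ltwist r) y \<ominus> ev r y) \<oplus> ev (peeled (ltwist r)) y"
    if y: "\<And>w. y w \<in> carrier D" for y
  proof -
    have "ldiff r = (\<zero>, w0, \<one>) # ldiff p" by (simp add: r_def ldiff_def minus_eq r_neg)
    then have "ev (ldiff r) y = ev (ldiff p) y" using y p by simp
    then show ?thesis unfolding e_def using ev_append[OF terms_ldiff[OF p(1)] tr(2)] ev_ldiff[OF r(1)] y by simp
  qed
  have "ev e Y \<in> laurent"
  proof -
    obtain n where n: "n \<in> laurent" "s \<otimes> ev r Y = (ev (ltwist r) Y \<oplus> ev (peeled (ltwist r)) Y) \<oplus> n"
      using laurent_remainder[OF shifted_relation[OF r(1)]] tr r by auto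
    have "ev e Y = (s \<otimes> ev r Y \<ominus> n) \<ominus> ev r Y"
      unfolding e_ev[OF Y_closed] n(2) using tr r n(1) M(1) by (simp add: minus_eq a_ac r_neg r_neg1 r_neg2)
    then show ?thesis using n(1) rY M by simp
  qed
  then have e_zero: "ev e y = \<zero>" if "\<And>w. y w \<in> carrier D" for y
    using IH[OF e] that by blast
  show False
  proof (cases w0)
    case Nil
    have "w = w0" if "w \<in> W" for w using top(2)[OF that] Nil by simp
    then have "words_of q = {}" using q(3) by blast
    then have "q = []" by (cases q) auto
    then have "u = m" using q(1) M(1)[OF q(4)] unfolding Nil by simp
    then show False using u_not_laurent q(4) by simp
  next
    case (Cons j v)
    have "0 < j" using pos[OF top(1)] Cons by auto
    with separated[of j] obtain U where U: "fixed_subspace U" "\<And>i::nat. i \<noteq> j \<Longrightarrow> f [^] i \<in> U" "f [^] j \<notin> U"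
      "\<And>a. a \<in> E \<Longrightarrow> twist a \<ominus> a \<in> U"
      by auto
    define c where "c z = ev (coeff_at z r) (\<lambda>_. \<one>)" for z
    have cE: "c z \<in> E" for z unfolding c_def using r(1) by (intro ev_one_in_E) auto
    have c_w0: "c w0 = \<one>"
    proof -
      have "coeff_at w0 p = []" using p(2) by (intro coeff_at_eq_Nil) auto
      moreover have "coeff_at w0 r = (\<one>, w0, \<one>) # coeff_at w0 p" by (simp add: r_def coeff_at_def)
      ultimately show ?thesis by (simp add: c_def)
    qed
    have const: "ev (ltwist (coeff_at z r)) (\<lambda>_. x) = x \<otimes> c z"
      if z: "length z = length w0" and x: "x \<in> carrier D" for z x
    proof -
      have comm: "ev (ldiff (coeff_at z r)) (\<lambda>_. x) = \<zero>" if x: "x \<in> carrier D" for x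
      proof -
        \<comment> \<open>Testing on a family concentrated at one word extracts the coefficient there.\<close>
      let ?y = "\<lambda>w. if w = z then x else \<zero>"
        have y: "?y w \<in> carrier D" for w using x by simp
        have "ev (peeled (ltwist r)) ?y = \<zero>"
        proof (rule ev_zero[OF tr(2)])
          fix a w b assume "(a, w, b) \<in> set (peeled (ltwist r))"
          then have "w \<in> words_of (peeled (ltwist r))" by (auto simp: words_of_iff)
          then obtain i where "i # w \<in> W" using r by (auto simp: words_of_peeled)
          then have "w \<noteq> z" using top(2)[of "i # w"] z by auto
          then show "?y w = \<zero>" by simp
        qed
        then have "ev (ltwist r) ?y \<ominus> ev r ?y = \<zero>"
          using e_ev[of ?y, OF y] e_zero[of ?y, OF y] r(1) y by simp
        then have "ev (ltwist (coeff_at z r)) (\<lambda>_. x) \<ominus> ev (coeff_at z r) (\<lambda>_. x) = \<zero>"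
          using ev_single[OF r(1) x, of z] ev_single[OF tr(1) x, of z] by (simp add: coeff_at_ltwist)
        then show ?thesis using ev_ldiff[of "coeff_at z r" "\<lambda>_. x"] r(1) x by simp
      qed
      have "ev (ltwist (coeff_at z r)) (\<lambda>_. x) \<ominus> ev (coeff_at z r) (\<lambda>_. x) = \<zero>"
        using comm[OF x] ev_ldiff[of "coeff_at z r" "\<lambda>_. x"] r(1) x by simp
      then have "ev (ltwist (coeff_at z r)) (\<lambda>_. x) = ev (coeff_at z r) (\<lambda>_. x)"
        using r(1) x by simp
      then show ?thesis unfolding c_def using commuting_imp_constant[OF _ comm x] r(1) by simp
    qed
    define Z where "Z = {z \<in> W. z \<noteq> [] \<and> tl z = v} - {w0}"
    have "finite Z" using fin by (simp add: Z_def)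
    then obtain zs where zs: "set zs = Z" "distinct zs" using finite_distinct_list by blast
    have Z: "\<exists>i. z = i # v \<and> i \<noteq> j" if "z \<in> set zs" for z
    proof -
      from that zs(1) have "z \<noteq> []" "tl z = v" "z \<noteq> w0" by (auto simp: Z_def)
      then have "z = hd z # v" "hd z \<noteq> j" using Cons by (cases z; simp)+
      then show ?thesis by metis
    qed
    define l where "l = map (\<lambda>z. (f [^] hd z, z, c z)) zs @ ldiff (coeff_at v r)"
    have l: "terms l" unfolding l_def using r(1) cE by (auto simp: terms_def[of "map _ _"])
    have l_U: "a \<in> U" if "(a, w, b) \<in> set l" for a w b
    proof -
      from that consider "(a, w, b) \<in> set (map (\<lambda>z. (f [^] hd z, z, c z)) zs)"
        | "(a, w, b) \<in> set (ldiff (coeff_at v r))" unfolding l_def by auto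
      then show ?thesis
      proof cases
        case 1
        then obtain z where z: "z \<in> set zs" "a = f [^] hd z" by auto
        with Z[OF z(1)] show ?thesis using U(2) by auto
      next
        case 2
        then obtain a' where "a = twist a' \<ominus> a'" "(a', w, b) \<in> set (coeff_at v r)"
          by (auto simp: ldiff_def)
        moreover from this have "a' \<in> E" using terms_parts(1)[OF r(1)] by (auto simp: terms_def)
        ultimately show ?thesis using U(4) by simp
      qed
    qed
    have rel: "f [^] j \<otimes> x \<oplus> ev l (\<lambda>_. x) = \<zero>" if x: "x \<in> carrier D" for x
    proof -
      let ?y = "\<lambda>w. if w = v then x else \<zero>"
      have y: "?y w \<in> carrier D" for w using x by simp
      have "ev (peeled (ltwist r)) ?y = ev (ltwist r) (peel ?y)"
        by (rule ev_peeled[OF tr(1) y])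
      also have "\<dots> = ev (map (\<lambda>z. (f [^] hd z, z, c z)) (w0 # zs)) (\<lambda>_. x)"
      proof (rule ev_by_coefficients[OF _ tr(1) x])
        show "distinct (w0 # zs)" using zs by (auto simp: Z_def)
        show "peel ?y w \<in> carrier D" for w by (rule peel_closed[OF y])
      next
        fix w assume "w \<in> words_of (ltwist r)" "w \<notin> set (w0 # zs)"
        then have "w = [] \<or> tl w \<noteq> v" using r(2) zs by (auto simp: Z_def)
        then show "peel ?y w = \<zero>" by (cases w) (auto simp: peel_def)
      next
        fix z assume "z \<in> set (w0 # zs)"
        then obtain i where z: "z = i # v" using Z Cons by auto
        then have "length z = length w0" using Cons by simp
        from const[OF this, of "f [^] i \<otimes> x"] x z
        show "ev (coeff_at z (ltwist r)) (\<lambda>_. peel ?y z) = f [^] hd z \<otimes> x \<otimes> c z"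
          by (simp add: peel_def coeff_at_ltwist)
      qed
      finally have 1: "ev (peeled (ltwist r)) ?y = f [^] j \<otimes> x \<oplus> ev (map (\<lambda>z. (f [^] hd z, z, c z)) zs) (\<lambda>_. x)"
        using c_w0 Cons x by simp
      have 2: "ev (ltwist r) ?y \<ominus> ev r ?y = ev (ldiff (coeff_at v r)) (\<lambda>_. x)"
        using ev_single[OF r(1) x, of v] ev_single[OF tr(1) x, of v] ev_ldiff[of "coeff_at v r" "\<lambda>_. x"] r(1) x
        by (simp add: coeff_at_ltwist)
      have t1: "terms (map (\<lambda>z. (f [^] hd z, z, c z)) zs)" and t2: "terms (ldiff (coeff_at v r))"
        using l by (auto simp: l_def)
      have cl: "ev (map (\<lambda>z. (f [^] hd z, z, c z)) zs) (\<lambda>_. x) \<in> carrier D"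
        "ev (ldiff (coeff_at v r)) (\<lambda>_. x) \<in> carrier D"
        using t1 t2 x by auto
      have "ev (ldiff (coeff_at v r)) (\<lambda>_. x) \<oplus>
          (f [^] j \<otimes> x \<oplus> ev (map (\<lambda>z. (f [^] hd z, z, c z)) zs) (\<lambda>_. x)) = \<zero>"
        using e_ev[of ?y, OF y] e_zero[of ?y, OF y] unfolding 1 2 by simp
      moreover have "ev l (\<lambda>_. x) = ev (map (\<lambda>z. (f [^] hd z, z, c z)) zs) (\<lambda>_. x) \<oplus> ev (ldiff (coeff_at v r)) (\<lambda>_. x)"
        unfolding l_def by (rule ev_append[OF t1 t2]) (use x in simp)
      ultimately show ?thesis using cl x by (simp add: a_ac)
    qed
    have "f [^] j \<in> U"
    proof (rule tensor_separation_left[OF U(1) l])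
      show "f [^] j \<in> E" by (rule f_pow_E)
      show "a \<in> U" if "(a, w, b) \<in> set l" for a w b using that by (rule l_U)
      show "f [^] j \<otimes> x \<oplus> ev l (\<lambda>_. x) = \<zero>" if "x \<in> carrier D" for x using that by (rule rel)
    qed
    with U(3) show False ..
  qed
qed

text \<open>
  Induction on the number of words. A word of maximal length is removed: its coefficient is zero, since
  otherwise \<open>bimodule_simplicity\<close>, applied to the span of the remaining words, would put \<open>Y w0\<close> into that
  span. Closure under tails is what makes the spans stable under \<open>s\<close>.
\<close>

theorem words_independent:
  assumes "finite W" "\<And>w. w \<in> W \<Longrightarrow> 0 \<notin> set w" "\<And>i v. i # v \<in> W \<Longrightarrow> v \<in> W"
    and "terms r" "words_of r \<subseteq> W" "ev r Y \<in> laurent" "\<And>w. y w \<in> carrier D"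
  shows "ev r y = \<zero>"
  using assms
proof (induction "card W" arbitrary: W r y)
  case 0
  then have "words_of r = {}" by auto
  then have "r = []" by (cases r) auto
  then show ?case by simp
next
  case (Suc n)
  then have "W \<noteq> {}" by auto
  then have "Max (length ` W) \<in> length ` W" using Suc.prems(1) by (intro Max_in) auto
  then obtain w0 where w0: "w0 \<in> W" "Max (length ` W) = length w0" by auto
  have top: "length w \<le> length w0" if "w \<in> W" for w
    unfolding w0(2) [symmetric] using that Suc.prems(1) by (intro Max_ge) auto
  let ?V = "W - {w0}"
  have V: "n = card ?V" "finite ?V" "\<And>w. w \<in> ?V \<Longrightarrow> 0 \<notin> set w"
    using Suc.hyps(2) Suc.prems(1,2) w0(1) by auto
  have V_tail: "v \<in> ?V" if "i # v \<in> ?V" for i v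
    using that Suc.prems(3)[of i v] top[of "i # v"] by auto
  have IH: "ev r y = \<zero>"
    if "terms r" "words_of r \<subseteq> ?V" "ev r Y \<in> laurent" "\<And>w. y w \<in> carrier D" for r y
    by (rule Suc.hyps(1)[of ?V, OF V(1,2) _ _ that]) (rule V(3), assumption, rule V_tail, assumption)
  have not_in: "Y w0 \<notin> span_mod_laurent ?V"
    by (rule top_word_independent[OF Suc.prems(2,1,3) w0(1) top IH])
  have span: "shift_bimodule (span_mod_laurent ?V)" by (rule shift_bimodule_span) (rule V_tail)
  have off: "terms (off w0 r)" "words_of (off w0 r) \<subseteq> ?V"
    using Suc.prems(4,5) by (auto simp: words_of_off)
  have coeff: "terms (coeff_at w0 r)" using Suc.prems(4) by auto
  note M = shift_bimoduleD[OF shift_bimodule_laurent]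
  have in_span: "ev r' Y \<oplus> m \<in> span_mod_laurent ?V" if "terms r'" "words_of r' \<subseteq> ?V" "m \<in> laurent" for r' m
    using that unfolding span_mod_laurent_def by blast
  have split: "ev r y = ev (coeff_at w0 r) (\<lambda>_. y w0) \<oplus> ev (off w0 r) y" if "\<And>w. y w \<in> carrier D" for y
    using ev_split_at[OF Suc.prems(4)] that by blast
  have zero: "ev (coeff_at w0 r) (\<lambda>_. x) = \<zero>" if x: "x \<in> carrier D" for x
  proof (rule ccontr)
    assume nonzero: "ev (coeff_at w0 r) (\<lambda>_. x) \<noteq> \<zero>"
    have "ev r Y \<ominus> ev (off w0 r) Y \<in> span_mod_laurent ?V"
      using shift_bimoduleD(4)[OF span, of "ev r Y" "ev (off w0 r) Y"]
        in_span[of "[]" "ev r Y"] in_span[OF off M(2)] Suc.prems(4,6) off by simp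
    then have val: "ev (coeff_at w0 r) (\<lambda>_. Y w0) \<in> span_mod_laurent ?V"
      using split[OF Y_closed] coeff off by (simp add: minus_eq a_assoc r_neg)
    have "s \<otimes> Y w0 \<ominus> Y w0 \<in> span_mod_laurent ?V"
    proof -
      obtain m where m: "m \<in> laurent" "s \<otimes> Y w0 = (Y w0 \<oplus> peel Y w0) \<oplus> m"
        using laurent_remainder[OF s_Y[of w0]] by auto
      then have eq: "s \<otimes> Y w0 \<ominus> Y w0 = peel Y w0 \<oplus> m"
        using M(1) by (simp add: minus_eq a_ac r_neg r_neg1 r_neg2)
      show ?thesis
      proof (cases w0)
        case Nil
        then show ?thesis unfolding eq using in_span[of "[]" m] m(1) by (simp add: peel_def)
      next
        case (Cons i v)
        then have "v \<in> ?V" using Suc.prems(3) w0(1) by auto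
        then show ?thesis unfolding eq using in_span[of "[(f [^] i, v, \<one>)]" m] m(1) Cons by (simp add: peel_def)
      qed
    qed
    from bimodule_simplicity[OF span Y_closed this coeff val x nonzero] not_in show False by contradiction
  qed
  have "ev (off w0 r) Y \<in> laurent" using split[OF Y_closed] zero Suc.prems(6) off by simp
  from IH[OF off this] Suc.prems(7) have "ev (off w0 r) y = \<zero>" by blast
  with split zero Suc.prems(7) show ?case by simp
qed

end

section \<open>Monomials in two generators\<close>

text \<open>
  Words in the letters \<open>f\<close> (for \<open>True\<close>) and \<open>u f\<close> (for \<open>False\<close>). The result \<open>(i, None)\<close> stands for \<open>f\<^sup>i\<close>, and
  \<open>(i, Some (v, j))\<close> stands for \<open>f\<^sup>i (Y v) f\<^sup>j\<close>. A letter \<open>u f\<close> increments the exponent that follows it,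
  because it contributes a factor \<open>f\<close> to the power in front of the rest of the word. This is why
  all exponents but the first are positive.
\<close>

fun decode :: "bool list \<Rightarrow> nat \<times> (nat list \<times> nat) option" where
  "decode [] = (0, None)"
| "decode (True # w) = apfst Suc (decode w)"
| "decode (False # w) = (0, case decode w of
     (i, None) \<Rightarrow> Some ([], Suc i) | (i, Some (v, j)) \<Rightarrow> Some (Suc i # v, j))"

lemma decode_positive: "decode w = (i, Some (v, j)) \<Longrightarrow> 0 < j \<and> 0 \<notin> set v"
  by (induction w arbitrary: i v j rule: decode.induct)
    (auto simp: apfst_def map_prod_def split: prod.splits option.splits)

lemma decode_False: "snd (decode (False # w)) \<noteq> None"
  by (simp split: prod.split option.split)

lemma decode_inject: "decode w = decode w' \<Longrightarrow> w = w'"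
proof (induction w arbitrary: w' rule: decode.induct)
  case 1
  then show ?case
  proof (cases w' rule: decode.cases)
    case (3 w'')
    with 1 decode_False[of w''] show ?thesis by (metis decode.simps(1) snd_conv)
  qed (auto simp: prod_eq_iff)
next
  case (2 w)
  then show ?case by (cases w' rule: decode.cases) (auto simp: prod_eq_iff)
next
  case (3 w)
  then show ?case
  proof (cases w' rule: decode.cases)
    case 1
    with "3.prems" decode_False[of w] show ?thesis by (metis decode.simps(1) snd_conv)
  next
    case w': (3 w'')
    obtain i c i' c' where d: "decode w = (i, c)" "decode w'' = (i', c')"
      by (cases "decode w", cases "decode w''")
    from "3.prems" have "i = i'" "c = c'"
      unfolding w' by (auto simp: d split: option.splits)
    with d w' "3.IH"[of w''] show ?thesis by simp
  qed (auto simp: prod_eq_iff)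
qed

context separated_powers
begin

definition decoded_value :: "nat \<times> (nat list \<times> nat) option \<Rightarrow> 'd" where
  "decoded_value c = f [^] fst c \<otimes> (case snd c of None \<Rightarrow> \<one> | Some (v, j) \<Rightarrow> Y v \<otimes> f [^] j)"

lemma f_closed [simp, intro]: "f \<in> carrier D" using f_E E_sub by auto

lemma word_value_decode: "word_value D (case_bool f (u \<otimes> f)) w = decoded_value (decode w)"
proof (induction w rule: decode.induct)
  case 1
  then show ?case by (simp add: word_value_def decoded_value_def)
next
  case (2 w)
  obtain i c where d: "decode w = (i, c)" by (cases "decode w")
  have "(case c of None \<Rightarrow> \<one> | Some (v, j) \<Rightarrow> Y v \<otimes> f [^] j) \<in> carrier D" by (auto split: option.split)
  moreover have "f [^] Suc i = f \<otimes> f [^] i" using nat_pow_Suc2 f_closed by blast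
  moreover have "word_value D (case_bool f (u \<otimes> f)) (True # w) = f \<otimes> decoded_value (decode w)"
    using 2 by (simp add: word_value_def)
  ultimately show ?case using d by (simp add: decoded_value_def m_assoc del: nat_pow_Suc)
next
  case (3 w)
  obtain i c where d: "decode w = (i, c)" by (cases "decode w")
  have *: "f [^] Suc i = f \<otimes> f [^] i" using nat_pow_Suc2 f_closed by blast
  have "word_value D (case_bool f (u \<otimes> f)) (False # w) = u \<otimes> f \<otimes> decoded_value (decode w)"
    using 3 by (simp add: word_value_def)
  then show ?case using d *
    by (cases c) (auto simp: decoded_value_def m_assoc simp del: nat_pow_Suc)
qed

text \<open>
  The words without \<open>False\<close> contribute an element of \<open>E\<close> to a relation, so that the rest of the relation is
  trivial by \<open>words_independent\<close>. Its coefficient at a word \<open>v\<close> is \<open>\<Sum> c f\<^sup>i \<otimes> f\<^sup>j\<close>, and the separating subspaces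
  for \<open>i\<close> and \<open>j\<close> isolate each single \<open>c\<close> by \<open>tensor_separation\<close>. What remains is a polynomial
  relation for \<open>f\<close> alone.
\<close>

theorem free_generators_powers:
  "free_generators D fixed_field (case_bool f (t \<otimes> inv (\<one> \<ominus> t) \<otimes> f))"
  unfolding free_generators_def u_def [symmetric]
proof (intro conjI allI impI)
  show "range (case_bool f (u \<otimes> f)) \<subseteq> carrier D" by (auto split: bool.split)
next
  fix W :: "bool list set" and c :: "bool list \<Rightarrow> 'd"
  assume fin: "finite W" and c: "c \<in> W \<rightarrow> fixed_field"
    and sum: "(\<Oplus>w\<in>W. c w \<otimes> word_value D (case_bool f (u \<otimes> f)) w) = \<zero>"
  \<comment> \<open>A word in \<open>W1\<close> has the value \<open>f [^] h w \<otimes> (Y (mid w) \<otimes> f [^] l w)\<close>.\<close>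
  define h where "h w = fst (decode w)" for w
  define mid where "mid w = fst (the (snd (decode w)))" for w
  define l where "l w = snd (the (snd (decode w)))" for w
  define W1 where "W1 = {w \<in> W. snd (decode w) \<noteq> None}"
  define W2 where "W2 = {w \<in> W. snd (decode w) = None}"
  have W12: "W = W1 \<union> W2" "W1 \<inter> W2 = {}" "finite W1" "finite W2"
    using fin by (auto simp: W1_def W2_def)
  have cK: "c w \<in> fixed_field" and cE: "c w \<in> E" and cD: "c w \<in> carrier D" if "w \<in> W" for w
    using that c fixed_field_E[of "c w"] E_sub[of "c w"] by auto
  have term1: "c w \<otimes> decoded_value (decode w) = c w \<otimes> f [^] h w \<otimes> Y (mid w) \<otimes> f [^] l w"
    if "w \<in> W1" for w
    using that cD[of w] by (auto simp: W1_def decoded_value_def h_def mid_def l_def m_assoc)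
  have term2: "c w \<otimes> decoded_value (decode w) = c w \<otimes> f [^] h w \<otimes> \<one> \<otimes> \<one>" if "w \<in> W2" for w
    using that cD[of w] by (auto simp: W2_def decoded_value_def h_def)
  define F where "F w = (c w \<otimes> f [^] h w, mid w, f [^] l w)" for w
  define G where "G w = (c w \<otimes> f [^] h w, (), \<one>)" for w
  have F_terms: "terms (map F ws)" and G_terms: "terms (map G ws)" if "set ws \<subseteq> W" for ws
    using that cE by (auto simp: terms_def F_def G_def)
  have ev_F: "ev (map F ws) y = (\<Oplus>w\<in>W1. c w \<otimes> f [^] h w \<otimes> y (mid w) \<otimes> f [^] l w)"
    if "distinct ws" "set ws = W1" "\<And>v. y v \<in> carrier D" for ws y
    unfolding F_def that(2) [symmetric]
    by (rule finsum_eq_ev [symmetric, OF that(1)]) (use that W12 cE in auto)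
  have ev_G: "ev (map G ws) (\<lambda>_. \<one>) = (\<Oplus>w\<in>W2. c w \<otimes> f [^] h w \<otimes> \<one> \<otimes> \<one>)"
    if "distinct ws" "set ws = W2" for ws
    unfolding G_def that(2) [symmetric]
    by (rule finsum_eq_ev [symmetric, OF that(1)]) (use that W12 cE in auto)
  obtain ws1 ws2 where ws: "set ws1 = W1" "distinct ws1" "set ws2 = W2" "distinct ws2"
    using W12 finite_distinct_list by metis
  have t1: "terms (map F ws1)" and t2: "terms (map G ws2)"
    using F_terms G_terms W12 ws by auto
  have S: "ev (map F ws1) Y \<oplus> ev (map G ws2) (\<lambda>_. \<one>) = \<zero>"
  proof -
    have dv: "decoded_value d \<in> carrier D" for d
      by (auto simp: decoded_value_def split: option.split)
    have "(\<Oplus>w\<in>W1 \<union> W2. c w \<otimes> decoded_value (decode w)) =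
        (\<Oplus>w\<in>W1. c w \<otimes> decoded_value (decode w)) \<oplus> (\<Oplus>w\<in>W2. c w \<otimes> decoded_value (decode w))"
      using W12 cD dv by (intro finsum_Un_disjoint) auto
    also have "(\<Oplus>w\<in>W1. c w \<otimes> decoded_value (decode w)) = ev (map F ws1) Y"
      unfolding ev_F[OF ws(2,1) Y_closed] using term1 W12 cD by (intro finsum_cong) (auto simp: simp_implies_def)
    also have "(\<Oplus>w\<in>W2. c w \<otimes> decoded_value (decode w)) = ev (map G ws2) (\<lambda>_. \<one>)"
      unfolding ev_G[OF ws(4,3)] using term2 W12 cD by (intro finsum_cong) (auto simp: simp_implies_def)
    finally show ?thesis using sum by (simp add: W12(1) word_value_decode)
  qed
  have S2: "ev (map G ws2) (\<lambda>_. \<one>) \<in> E" by (rule ev_one_in_E[OF t2])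
  have S1: "ev (map F ws1) Y \<in> carrier D" using t1 by auto
  have "ev (map F ws1) Y = \<ominus> ev (map G ws2) (\<lambda>_. \<one>)"
    using S S1 E_sub[OF S2] by (metis minus_equality a_comm minus_minus)
  then have S1_laurent: "ev (map F ws1) Y \<in> laurent" using S2 E_laurent by auto
  define V where "V = (\<Union>w\<in>W1. (\<lambda>k. drop k (mid w)) ` {..length (mid w)})"
  have V_fin: "finite V" using W12 by (auto simp: V_def)
  have V_pos: "0 \<notin> set v" if "v \<in> V" for v
  proof -
    obtain w k where w: "w \<in> W1" "v = drop k (mid w)" using \<open>v \<in> V\<close> by (auto simp: V_def)
    obtain i m j where "decode w = (i, Some (m, j))" using w(1) by (cases "decode w") (auto simp: W1_def)
    with decode_positive[OF this] have "0 \<notin> set (mid w)" by (simp add: mid_def)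
    then show ?thesis using w set_drop_subset[of k "mid w"] by auto
  qed
  have V_tail: "v \<in> V" if "i # v \<in> V" for i v
  proof -
    obtain w k where w: "w \<in> W1" "i # v = drop k (mid w)" using \<open>i # v \<in> V\<close> by (auto simp: V_def)
    then have "v = drop (Suc k) (mid w)" by (metis drop_Suc list.sel(3) tl_drop)
    moreover have "k < length (mid w)" using w(2) by (metis drop_all leI list.distinct(1))
    ultimately show ?thesis using w(1) unfolding V_def by (intro UN_I[OF w(1)] image_eqI[of _ _ "Suc k"]) auto
  qed
  have V_words: "words_of (map F ws1) \<subseteq> V"
    using ws(1) by (force simp: words_of_def V_def F_def)
  have zero: "ev (map F ws1) y = \<zero>" if "\<And>v. y v \<in> carrier D" for y
    by (rule words_independent[OF V_fin V_pos V_tail t1 V_words S1_laurent that])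
  have c1: "c w = \<zero>" if w: "w \<in> W1" for w
  proof (rule ccontr)
    assume c_nz: "c w \<noteq> \<zero>"
    have wW: "w \<in> W" using w W12 by auto
    obtain U where U: "fixed_subspace U" "\<And>j. j \<noteq> h w \<Longrightarrow> f [^] j \<in> U" "f [^] h w \<notin> U"
      using separated[of "h w"] by auto
    obtain U' where U': "fixed_subspace U'" "\<And>j. j \<noteq> l w \<Longrightarrow> f [^] j \<in> U'" "f [^] l w \<notin> U'"
      using separated[of "l w"] by auto
    \<comment> \<open>Terms at the same word differ from \<open>w\<close> in the first exponent (\<open>?A\<close>) or only in the last one (\<open>?B\<close>).\<close>
    let ?A = "{w' \<in> W1. mid w' = mid w \<and> h w' \<noteq> h w}"
    let ?B = "{w' \<in> W1. mid w' = mid w \<and> h w' = h w \<and> w' \<noteq> w}"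
    let ?C = "{w' \<in> W1. mid w' \<noteq> mid w}"
    have fABC: "finite ?A" "finite ?B" "finite ?C" using W12 by auto
    obtain as where as: "set as = ?A" "distinct as" using finite_distinct_list[OF fABC(1)] by blast
    obtain bs where bs: "set bs = ?B" "distinct bs" using finite_distinct_list[OF fABC(2)] by blast
    obtain cs where cs: "set cs = ?C" "distinct cs" using finite_distinct_list[OF fABC(3)] by blast
    note L = as bs cs
    have dist: "distinct (w # as @ bs @ cs)" "set (w # as @ bs @ cs) = W1"
      using L w by auto
    have tt: "terms (map F as)" "terms (map F bs)" "terms (map F cs)"
      using L W12 by (auto intro!: F_terms)
    have rel: "c w \<otimes> f [^] h w \<otimes> x \<otimes> f [^] l w \<oplus> (ev (map F as) (\<lambda>_. x) \<oplus> ev (map F bs) (\<lambda>_. x)) = \<zero>"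
      if x: "x \<in> carrier D" for x
    proof -
      let ?y = "\<lambda>v. if v = mid w then x else \<zero>"
      have y: "?y v \<in> carrier D" for v using x by simp
      have "ev (map F (w # as @ bs @ cs)) ?y = ev (map F ws1) ?y"
        using ev_F[of _ ?y, OF dist y] ev_F[of _ ?y, OF ws(2,1) y] by simp
      then have "ev (map F (w # as @ bs @ cs)) ?y = \<zero>" using zero[of ?y, OF y] by simp
      moreover have "ev (map F cs) ?y = \<zero>" using L(5) by (intro ev_zero[OF tt(3)]) (auto simp: F_def)
      moreover have "ev (map F as) ?y = ev (map F as) (\<lambda>_. x)" using L(1) by (intro ev_cong) (auto simp: F_def)
      moreover have "ev (map F bs) ?y = ev (map F bs) (\<lambda>_. x)" using L(3) by (intro ev_cong) (auto simp: F_def)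
      moreover have "ev (map F (as @ bs @ cs)) ?y = ev (map F as) ?y \<oplus> (ev (map F bs) ?y \<oplus> ev (map F cs) ?y)"
        unfolding map_append using ev_append[of "map F as" "map F bs @ map F cs" ?y]
          ev_append[of "map F bs" "map F cs" ?y] tt y by simp
      moreover have "ev (map F (w # as @ bs @ cs)) ?y =
          c w \<otimes> f [^] h w \<otimes> x \<otimes> f [^] l w \<oplus> ev (map F (as @ bs @ cs)) ?y"
        by (simp add: F_def)
      moreover have "ev (map F bs) (\<lambda>_. x) \<in> carrier D" using tt x by auto
      ultimately show ?thesis by simp
    qed
    have asU: "a \<in> U" if "(a, v, b) \<in> set (map F as)" for a v b
    proof -
      from that obtain w' where w': "w' \<in> set as" "a = c w' \<otimes> f [^] h w'" by (auto simp: F_def)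
      then have "w' \<in> W" "h w' \<noteq> h w" unfolding L(1) using W12(1) by auto
      then show ?thesis using fixed_subspaceD(5)[OF U(1) U(2) cK] w'(2) by simp
    qed
    have bsU: "b \<in> U'" if "(a, v, b) \<in> set (map F bs)" for a v b
    proof -
      from that obtain w' where "w' \<in> set bs" and b: "b = f [^] l w'" by (auto simp: F_def)
      then have w': "w' \<in> W1" "mid w' = mid w" "h w' = h w" "w' \<noteq> w" unfolding L(3) by auto
      have "l w' \<noteq> l w"
      proof
        assume "l w' = l w"
        then have "decode w' = decode w"
          using w' w by (auto simp: W1_def h_def mid_def l_def prod_eq_iff)
        then show False using decode_inject w'(4) by blast
      qed
      then show ?thesis using U'(2) b by simp
    qed
    have "c w \<otimes> f [^] h w \<in> U \<or> f [^] l w \<in> U'"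
    proof (rule tensor_separation[OF U(1) U'(1) tt(1,2)])
      show "c w \<otimes> f [^] h w \<in> E" "f [^] l w \<in> E" using cE[OF wW] by auto
    qed (fact asU bsU rel)+
    then have "inv (c w) \<otimes> (c w \<otimes> f [^] h w) \<in> U"
      using U'(3) fixed_subspaceD(5)[OF U(1) _ fixed_field_closed(6)[OF cK[OF wW] c_nz]] by simp
    then show False using U(3) inverse[OF cD[OF wW] c_nz] cD[OF wW] by (simp add: m_assoc [symmetric])
  qed
  have c2: "c w = \<zero>" if w: "w \<in> W2" for w
  proof (rule ccontr)
    assume c_nz: "c w \<noteq> \<zero>"
    have wW: "w \<in> W" using w W12 by auto
    obtain U where U: "fixed_subspace U" "\<And>j. j \<noteq> h w \<Longrightarrow> f [^] j \<in> U" "f [^] h w \<notin> U"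
      using separated[of "h w"] by auto
    obtain as where as: "set as = W2 - {w}" "distinct as"
      using W12 finite_distinct_list[of "W2 - {w}"] by auto
    have dist: "distinct (w # as)" "set (w # as) = W2" using as w by auto
    have "ev (map G (w # as)) (\<lambda>_. \<one>) = \<zero>"
      using S zero[of Y, OF Y_closed] ev_G[OF dist] ev_G[OF ws(4,3)] E_sub[OF S2] by simp
    then have "c w \<otimes> f [^] h w \<oplus> ev (map G as) (\<lambda>_. \<one>) = \<zero>"
      using cD[OF wW] by (simp add: G_def)
    moreover have A: "ev (map G as) (\<lambda>_. \<one>) \<in> U"
    proof (rule ev_one_in_subspace[OF U(1)])
      fix a v b assume "(a, v, b) \<in> set (map G as)"
      then obtain w' where w': "w' \<in> W2" "w' \<noteq> w" "a = c w' \<otimes> f [^] h w'" "b = \<one>"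
        using as by (auto simp: G_def)
      have "h w' \<noteq> h w"
      proof
        assume "h w' = h w"
        then have "decode w' = decode w" using w' w by (auto simp: W2_def h_def prod_eq_iff)
        then show False using decode_inject w'(2) by blast
      qed
      then show "a \<in> U \<and> b \<in> fixed_field"
        using w' fixed_subspaceD(5)[OF U(1) U(2) cK] W12 fixed_field_closed(2) by auto
    qed
    ultimately have "c w \<otimes> f [^] h w = \<ominus> ev (map G as) (\<lambda>_. \<one>)"
      using cD[OF wW] fixed_subspaceD(2)[OF U(1) A]
      by (metis minus_equality a_comm minus_minus m_closed f_pow_closed)
    then have "c w \<otimes> f [^] h w \<in> U" using fixed_subspaceD(7)[OF U(1) A] by simp
    then have "inv (c w) \<otimes> (c w \<otimes> f [^] h w) \<in> U"
      using fixed_subspaceD(5)[OF U(1)] fixed_field_closed(6)[OF cK[OF wW] c_nz] by blast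
    then show False using U(3) inverse[OF cD[OF wW] c_nz] cD[OF wW] by (simp add: m_assoc [symmetric])
  qed
  show "\<forall>w\<in>W. c w = \<zero>" using c1 c2 W12 by blast
qed

end

section \<open>Powers of an element modulo differences\<close>

locale difference_field = field L for L :: "('a, 'm) ring_scheme" (structure) +
  fixes \<sigma> :: "'a \<Rightarrow> 'a" and K :: "'a set"
  assumes iso: "\<sigma> \<in> ring_iso L L"
    and K_fixed: "K = {x \<in> carrier L. \<sigma> x = x}"
    and K_subfield: "subfield K L"
begin

lemma \<sigma>_closed [simp, intro]: "a \<in> carrier L \<Longrightarrow> \<sigma> a \<in> carrier L"
  using ring_iso_memE(1)[OF iso] by auto

lemma \<sigma>_hom:
  "a \<in> carrier L \<Longrightarrow> b \<in> carrier L \<Longrightarrow> \<sigma> (a \<oplus> b) = \<sigma> a \<oplus> \<sigma> b"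
  "a \<in> carrier L \<Longrightarrow> b \<in> carrier L \<Longrightarrow> \<sigma> (a \<otimes> b) = \<sigma> a \<otimes> \<sigma> b"
  "\<sigma> \<one> = \<one>" "\<sigma> \<zero> = \<zero>"
proof -
  show "a \<in> carrier L \<Longrightarrow> b \<in> carrier L \<Longrightarrow> \<sigma> (a \<oplus> b) = \<sigma> a \<oplus> \<sigma> b"
    "a \<in> carrier L \<Longrightarrow> b \<in> carrier L \<Longrightarrow> \<sigma> (a \<otimes> b) = \<sigma> a \<otimes> \<sigma> b" "\<sigma> \<one> = \<one>"
    using ring_iso_memE[OF iso] by auto
  have "\<sigma> \<zero> \<oplus> \<sigma> \<zero> = \<sigma> \<zero> \<oplus> \<zero>" using ring_iso_memE(3)[OF iso, of \<zero> \<zero>] by simp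
  then show "\<sigma> \<zero> = \<zero>" by simp
qed

lemma iterate_closed [simp, intro]: "a \<in> carrier L \<Longrightarrow> (\<sigma> ^^ n) a \<in> carrier L"
  and iterate_one [simp]: "(\<sigma> ^^ n) \<one> = \<one>"
  and iterate_zero [simp]: "(\<sigma> ^^ n) \<zero> = \<zero>"
  by (induction n) (auto simp: \<sigma>_hom)

lemma K_closed:
  "k \<in> K \<Longrightarrow> k \<in> carrier L" "\<zero> \<in> K" "\<one> \<in> K" "k \<in> K \<Longrightarrow> l \<in> K \<Longrightarrow> k \<otimes> l \<in> K" "k \<in> K \<Longrightarrow> \<ominus> k \<in> K"
  "k \<in> K \<Longrightarrow> \<sigma> k = k"
  using subringE[OF subfieldE(1)[OF K_subfield]] K_fixed by auto

lemma eval_scalar: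
  assumes "k \<in> carrier L" "set p \<subseteq> carrier L" "x \<in> carrier L"
  shows "eval (map (\<lambda>b. k \<otimes> b) p) x = k \<otimes> eval p x"
  using assms(2)
proof (induction p)
  case (Cons c p)
  then show ?case using assms eval_in_carrier[of p x] by (simp add: m_assoc r_distr)
qed (use assms in simp)

text \<open>
  The combinations over \<open>K\<close> of the powers of \<open>x\<close> other than the \<open>i\<close>-th, modulo \<open>\<Delta>(L)\<close> if \<open>i\<close> is positive.
  The lists \<open>p\<close> need not have a nonzero leading entry, which makes closure under scalars immediate.
\<close>

definition power_span :: "'a \<Rightarrow> nat \<Rightarrow> 'a set" where
  "power_span x i = {(\<sigma> a \<ominus> a) \<oplus> eval p x |a p.
     a \<in> carrier L \<and> (i = 0 \<longrightarrow> a = \<zero>) \<and> set p \<subseteq> K \<and> coeff p i = \<zero>}"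

lemma power_span_closed:
  assumes x: "x \<in> carrier L"
  shows "power_span x i \<subseteq> carrier L" "\<zero> \<in> power_span x i"
    "v \<in> power_span x i \<Longrightarrow> w \<in> power_span x i \<Longrightarrow> v \<oplus> w \<in> power_span x i"
    "v \<in> power_span x i \<Longrightarrow> k \<in> K \<Longrightarrow> k \<otimes> v \<in> power_span x i"
proof -
  have sub: "set p \<subseteq> carrier L" if "set p \<subseteq> K" for p using that K_closed(1) by auto
  have ev: "eval p x \<in> carrier L" if "set p \<subseteq> K" for p using eval_in_carrier[OF sub[OF that] x] .
  show "power_span x i \<subseteq> carrier L" using ev by (auto simp: power_span_def)
  show "\<zero> \<in> power_span x i"
    unfolding power_span_def
    by (intro CollectI exI[of _ \<zero>] exI[of _ "[]"]) (simp add: \<sigma>_hom minus_eq)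
  show "v \<oplus> w \<in> power_span x i" if "v \<in> power_span x i" "w \<in> power_span x i"
  proof -
    from that obtain a p b q where v: "v = (\<sigma> a \<ominus> a) \<oplus> eval p x" "a \<in> carrier L" "i = 0 \<longrightarrow> a = \<zero>"
        "set p \<subseteq> K" "coeff p i = \<zero>"
      and w: "w = (\<sigma> b \<ominus> b) \<oplus> eval q x" "b \<in> carrier L" "i = 0 \<longrightarrow> b = \<zero>"
        "set q \<subseteq> K" "coeff q i = \<zero>"
      unfolding power_span_def by blast
    have "v \<oplus> w = (\<sigma> (a \<oplus> b) \<ominus> (a \<oplus> b)) \<oplus> eval (poly_add p q) x"
      unfolding v(1) w(1) eval_poly_add[OF sub[OF v(4)] sub[OF w(4)] x]
      using v(2) w(2) ev[OF v(4)] ev[OF w(4)] by (simp add: \<sigma>_hom minus_eq minus_add a_ac)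
    moreover have "set (poly_add p q) \<subseteq> K"
      using polynomial_incl poly_add_is_polynomial[OF subfieldE(1)[OF K_subfield] v(4) w(4)] by blast
    moreover have "coeff (poly_add p q) i = \<zero>"
      unfolding poly_add_coeff[OF sub[OF v(4)] sub[OF w(4)]] using v(5) w(5) by simp
    ultimately show ?thesis using v(2,3) w(2,3) unfolding power_span_def
      by (intro CollectI exI[of _ "a \<oplus> b"] exI[of _ "poly_add p q"]) simp
  qed
  show "k \<otimes> v \<in> power_span x i" if "v \<in> power_span x i" and k: "k \<in> K"
  proof -
    from that(1) obtain a p where v: "v = (\<sigma> a \<ominus> a) \<oplus> eval p x" "a \<in> carrier L" "i = 0 \<longrightarrow> a = \<zero>"
        "set p \<subseteq> K" "coeff p i = \<zero>"
      unfolding power_span_def by blast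
    let ?p = "map (\<lambda>b. k \<otimes> b) p"
    have "k \<otimes> v = (\<sigma> (k \<otimes> a) \<ominus> (k \<otimes> a)) \<oplus> eval ?p x"
      unfolding v(1) eval_scalar[OF K_closed(1)[OF k] sub[OF v(4)] x]
      using v(2) ev[OF v(4)] K_closed(1,6)[OF k] by (simp add: \<sigma>_hom minus_eq r_distr r_minus)
    moreover have "set ?p \<subseteq> K" using v(4) K_closed(4)[OF k] by auto
    moreover have "coeff ?p i = \<zero>"
      unfolding scalar_coeff[OF K_closed(1)[OF k]] using v(5) K_closed(1)[OF k] by simp
    ultimately show ?thesis using v(2,3) K_closed(1)[OF k] unfolding power_span_def
      by (intro CollectI exI[of _ "k \<otimes> a"] exI[of _ ?p]) simp
  qed
qed

lemma power_in_power_span: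
  assumes x: "x \<in> carrier L" and "j \<noteq> i"
  shows "x [^] j \<in> power_span x i"
proof -
  have "x [^] j = (\<sigma> \<zero> \<ominus> \<zero>) \<oplus> eval (monom \<one> j) x"
    using x by (simp add: eval_monom \<sigma>_hom minus_eq)
  moreover have "set (monom \<one> j) \<subseteq> K" using K_closed by (auto simp: monom_def)
  moreover have "coeff (monom \<one> j) i = \<zero>" using assms by (simp add: monom_coeff)
  ultimately show ?thesis unfolding power_span_def
    by (intro CollectI exI[of _ \<zero>] exI[of _ "monom \<one> j"]) simp
qed

lemma difference_in_power_span:
  assumes "x \<in> carrier L" "0 < i" "a \<in> carrier L"
  shows "\<sigma> a \<ominus> a \<in> power_span x i"
  unfolding power_span_def using assms
  by (intro CollectI exI[of _ a] exI[of _ "[]"]) simp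

text \<open>
  If \<open>x\<^sup>i = \<Delta>(a) + p(x)\<close>, then \<open>\<Delta>(a) = x\<^sup>i - p(x)\<close> lies in \<open>A\<close> and hence equals some \<open>k\<close> in \<open>K\<close>. Then \<open>x\<close> is a
  root of \<open>X\<^sup>i - p - k\<close>. This polynomial is nonzero because its \<open>i\<close>-th coefficient is \<open>1\<close>: the constant \<open>k\<close>
  affects that coefficient only if \<open>i = 0\<close>, and in that case \<open>k = 0\<close>.
\<close>

lemma power_not_in_power_span:
  assumes A: "subring A L" "K \<subseteq> A" and diff: "(\<lambda>x. \<sigma> x \<ominus> x) ` carrier L \<inter> A \<subseteq> K"
    and x: "x \<in> A" and trans: "\<not> algebraic K x"
  shows "x [^] i \<notin> power_span x i"
proof
  have xL: "x \<in> carrier L" using x subringE(1)[OF A(1)] by auto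
  assume "x [^] i \<in> power_span x i"
  then obtain a p where *: "x [^] i = (\<sigma> a \<ominus> a) \<oplus> eval p x" "a \<in> carrier L" "i = 0 \<longrightarrow> a = \<zero>"
      "set p \<subseteq> K" "coeff p i = \<zero>"
    unfolding power_span_def by blast
  have powA: "x [^] n \<in> A" for n :: nat
    using subringE(3,6)[OF A(1)] x by (induction n) auto
  have evA: "eval q x \<in> A" if "set q \<subseteq> K" for q
    using that by (induction q) (use A(2) powA subringE(2,6,7)[OF A(1)] in auto)
  have pL: "set p \<subseteq> carrier L" using *(4) K_closed(1) by auto
  have pxL: "eval p x \<in> carrier L" using eval_in_carrier[OF pL xL] .
  define k where "k = \<sigma> a \<ominus> a"
  have kL: "k \<in> carrier L" using *(2) by (simp add: k_def)
  have "k = x [^] i \<oplus> \<ominus> eval p x"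
    using *(1) kL pxL by (simp add: k_def [symmetric] a_assoc r_neg)
  also have "\<dots> \<in> A" using powA evA[OF *(4)] subringE(5,7)[OF A(1)] by auto
  finally have kK: "k \<in> K" using diff *(2) k_def by auto
  define q where "q = map (\<lambda>b. \<ominus> \<one> \<otimes> b) p"
  define m where "m = poly_add (monom \<one> i) q"
  define r where "r = poly_add m [\<ominus> k]"
  have q: "set q \<subseteq> K" "set q \<subseteq> carrier L"
    using *(4) K_closed(1,3,4,5) by (auto simp: q_def)
  have mon: "set (monom \<one> i) \<subseteq> K" "set (monom \<one> i) \<subseteq> carrier L"
    using K_closed by (auto simp: monom_def)
  have m: "set m \<subseteq> K" "set m \<subseteq> carrier L"
    using polynomial_incl poly_add_is_polynomial[OF subfieldE(1)[OF K_subfield] mon(1) q(1)] K_closed(1)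
    unfolding m_def by blast+
  have k1: "set [\<ominus> k] \<subseteq> K" "set [\<ominus> k] \<subseteq> carrier L" using kK K_closed kL by auto
  have r: "polynomial K r"
    unfolding r_def by (rule poly_add_is_polynomial[OF subfieldE(1)[OF K_subfield] m(1) k1(1)])
  have "eval q x = \<ominus> eval p x"
    using eval_scalar[OF a_inv_closed[OF one_closed] pL xL] pxL by (simp add: q_def l_minus)
  then have "eval m x = x [^] i \<oplus> \<ominus> eval p x"
    using eval_poly_add[OF mon(2) q(2) xL] xL unfolding m_def by (simp add: eval_monom del: poly_add.simps)
  then have "eval r x = (x [^] i \<oplus> \<ominus> eval p x) \<oplus> \<ominus> k"
    using eval_poly_add[OF m(2) k1(2) xL] xL kL unfolding r_def by (simp del: poly_add.simps)
  also have "\<dots> = \<zero>"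
    unfolding *(1) k_def [symmetric] using kL pxL by (simp add: a_ac r_neg r_neg1 r_neg2)
  finally have root: "eval r x = \<zero>" .
  have "coeff [\<ominus> k] i = \<zero>"
    using *(3) by (cases "i = 0") (auto simp: k_def \<sigma>_hom minus_eq)
  moreover have "coeff q i = \<zero>"
    unfolding q_def scalar_coeff[OF a_inv_closed[OF one_closed]] using *(5) by simp
  then have "coeff m i = \<one>"
    unfolding m_def poly_add_coeff[OF mon(2) q(2)] monom_coeff by simp
  ultimately have "coeff r i = \<one>"
    unfolding r_def poly_add_coeff[OF m(2) k1(2)] by simp
  then have "r \<noteq> []" by auto
  then have "algebraic K x"
    using algebraicI[of r K x] r root univ_poly_carrier[of L K r] by (simp add: over_def)
  with trans show False by contradiction
qed

section \<open>Skew polynomials and their fractions\<close>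

abbreviation "S \<equiv> skew_poly L \<sigma>"
abbreviation "constant a \<equiv> up_ring.monom S a 0"
abbreviation "T \<equiv> up_ring.monom S \<one> 1"

lemma skew_poly_simps:
  "carrier S = up L" "\<zero>\<^bsub>S\<^esub> = (\<lambda>i. \<zero>)" "\<one>\<^bsub>S\<^esub> = (\<lambda>i. if i = 0 then \<one> else \<zero>)"
  "p \<in> up L \<Longrightarrow> q \<in> up L \<Longrightarrow> p \<oplus>\<^bsub>S\<^esub> q = (\<lambda>i. p i \<oplus> q i)"
  "a \<in> carrier L \<Longrightarrow> up_ring.monom S a n = (\<lambda>i. if i = n then a else \<zero>)"
  "p \<in> up L \<Longrightarrow> q \<in> up L \<Longrightarrow>
    p \<otimes>\<^bsub>S\<^esub> q = (\<lambda>n. \<Oplus>i \<in> {..n}. (\<sigma> ^^ (n - i)) (p i) \<otimes> q (n - i))"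
  by (simp_all add: skew_poly_def UP_def)

lemma monom_up [simp, intro]: "a \<in> carrier L \<Longrightarrow> up_ring.monom S a n \<in> up L"
  by (auto simp: skew_poly_simps intro!: mem_upI bound.intro exI[of _ n])

lemma up_closed [simp, intro]: "p \<in> up L \<Longrightarrow> p n \<in> carrier L"
  by (rule mem_upD)

lemma monom_mult:
  assumes a: "a \<in> carrier L" and q: "q \<in> up L"
  shows "up_ring.monom S a k \<otimes>\<^bsub>S\<^esub> q = (\<lambda>n. if k \<le> n then (\<sigma> ^^ (n - k)) a \<otimes> q (n - k) else \<zero>)"
proof
  fix n
  have "(up_ring.monom S a k \<otimes>\<^bsub>S\<^esub> q) n = (\<Oplus>i \<in> {..n}. (\<sigma> ^^ (n - i)) (if i = k then a else \<zero>) \<otimes> q (n - i))"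
    using a q by (simp add: skew_poly_simps(6)[OF monom_up]) (simp add: skew_poly_simps(5))
  also have "\<dots> = (\<Oplus>i \<in> {..n}. if k = i then (\<sigma> ^^ (n - i)) a \<otimes> q (n - i) else \<zero>)"
    using a q by (intro finsum_cong) (auto simp: simp_implies_def)
  also have "\<dots> = (if k \<le> n then (\<sigma> ^^ (n - k)) a \<otimes> q (n - k) else \<zero>)"
  proof (cases "k \<le> n")
    case True
    then show ?thesis using a q
      by (simp add: finsum_singleton[of k "{..n}" "\<lambda>i. (\<sigma> ^^ (n - i)) a \<otimes> q (n - i)"])
  next
    case False
    then have "(\<Oplus>i \<in> {..n}. if k = i then (\<sigma> ^^ (n - i)) a \<otimes> q (n - i) else \<zero>) = (\<Oplus>i \<in> {..n}. \<zero>)"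
      by (intro finsum_cong) (auto simp: simp_implies_def)
    with False show ?thesis by (simp add: finsum_zero)
  qed
  finally show "(up_ring.monom S a k \<otimes>\<^bsub>S\<^esub> q) n = (if k \<le> n then (\<sigma> ^^ (n - k)) a \<otimes> q (n - k) else \<zero>)" .
qed

lemma constant_mult: "a \<in> carrier L \<Longrightarrow> b \<in> carrier L \<Longrightarrow> constant a \<otimes>\<^bsub>S\<^esub> constant b = constant (a \<otimes> b)"
  by (simp only: monom_mult monom_up) (auto simp: skew_poly_simps(5) fun_eq_iff)

lemma constant_add: "a \<in> carrier L \<Longrightarrow> b \<in> carrier L \<Longrightarrow> constant a \<oplus>\<^bsub>S\<^esub> constant b = constant (a \<oplus> b)"
  by (simp only: skew_poly_simps(4) monom_up) (auto simp: skew_poly_simps(5) fun_eq_iff)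

lemma T_mult: "q \<in> up L \<Longrightarrow> T \<otimes>\<^bsub>S\<^esub> q = (\<lambda>n. case n of 0 \<Rightarrow> \<zero> | Suc m \<Rightarrow> q m)"
  by (simp only: monom_mult one_closed) (auto simp: fun_eq_iff split: nat.split)

lemma T_mult_up: "q \<in> up L \<Longrightarrow> T \<otimes>\<^bsub>S\<^esub> q \<in> up L"
proof -
  assume q: "q \<in> up L"
  then obtain n where n: "bound \<zero> n q" by auto
  have "bound \<zero> (Suc n) (T \<otimes>\<^bsub>S\<^esub> q)"
    unfolding T_mult[OF q] using n by (auto intro!: bound.intro split: nat.split)
  moreover have "(T \<otimes>\<^bsub>S\<^esub> q) m \<in> carrier L" for m
    unfolding T_mult[OF q] using q by (auto split: nat.split)
  ultimately show ?thesis by blast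
qed

lemma constant_T: "a \<in> carrier L \<Longrightarrow> constant a \<otimes>\<^bsub>S\<^esub> T = T \<otimes>\<^bsub>S\<^esub> constant (\<sigma> a)"
  by (simp only: monom_mult monom_up one_closed \<sigma>_closed) (auto simp: skew_poly_simps(5) fun_eq_iff)

lemma horner_coefficients:
  assumes "p \<in> up L" "a \<in> carrier L"
  shows "T \<otimes>\<^bsub>S\<^esub> p \<oplus>\<^bsub>S\<^esub> constant a = (\<lambda>n. case n of 0 \<Rightarrow> a | Suc m \<Rightarrow> p m)"
  using assms unfolding skew_poly_simps(4)[OF T_mult_up[OF assms(1)] monom_up[OF assms(2)]]
  by (subst T_mult[OF assms(1)]) (auto simp del: One_nat_def simp: skew_poly_simps(5) fun_eq_iff split: nat.split)

end

locale skew_fraction_ring = difference_field L \<sigma> K + D: ring D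
  for L :: "('a, 'm) ring_scheme" (structure) and \<sigma> K and D :: "('d, 'n) ring_scheme" +
  fixes \<iota> :: "(nat \<Rightarrow> 'a) \<Rightarrow> 'd"
  assumes fractions: "division_ring_of_fractions S D \<iota>"
begin

abbreviation "emb a \<equiv> \<iota> (constant a)"
definition t :: 'd where "t = \<iota> T"
abbreviation "E \<equiv> emb ` carrier L"

lemma D_units: "Units D = carrier D - {\<zero>\<^bsub>D\<^esub>}"
  using fractions by (simp add: division_ring_of_fractions_def)

lemma \<iota>_closed [simp, intro]: "p \<in> up L \<Longrightarrow> \<iota> p \<in> carrier D"
  and \<iota>_mult: "p \<in> up L \<Longrightarrow> q \<in> up L \<Longrightarrow> \<iota> (p \<otimes>\<^bsub>S\<^esub> q) = \<iota> p \<otimes>\<^bsub>D\<^esub> \<iota> q"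
  and \<iota>_add: "p \<in> up L \<Longrightarrow> q \<in> up L \<Longrightarrow> \<iota> (p \<oplus>\<^bsub>S\<^esub> q) = \<iota> p \<oplus>\<^bsub>D\<^esub> \<iota> q"
  and \<iota>_one: "\<iota> \<one>\<^bsub>S\<^esub> = \<one>\<^bsub>D\<^esub>"
  and \<iota>_inj: "p \<in> up L \<Longrightarrow> q \<in> up L \<Longrightarrow> \<iota> p = \<iota> q \<Longrightarrow> p = q"
  using fractions unfolding division_ring_of_fractions_def ring_hom_def skew_poly_simps(1)
  by (auto dest: inj_onD)

lemma \<iota>_zero: "\<iota> (\<lambda>_. \<zero>) = \<zero>\<^bsub>D\<^esub>"
proof -
  have z: "(\<lambda>_. \<zero>) \<in> up L" by (auto intro!: mem_upI bound.intro)
  have "(\<lambda>_. \<zero>) \<oplus>\<^bsub>S\<^esub> (\<lambda>_. \<zero>) = (\<lambda>_. \<zero>)" unfolding skew_poly_simps(4)[OF z z] by simp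
  then have "\<iota> (\<lambda>_. \<zero>) \<oplus>\<^bsub>D\<^esub> \<iota> (\<lambda>_. \<zero>) = \<iota> (\<lambda>_. \<zero>)" using \<iota>_add[OF z z] by simp
  then show ?thesis using z by (metis D.add.l_cancel_one \<iota>_closed)
qed

lemma emb_hom: "ring_hom_ring L D emb"
proof (rule ring_hom_ringI[OF ring_axioms D.ring_axioms])
  show "emb (a \<otimes> b) = emb a \<otimes>\<^bsub>D\<^esub> emb b" "emb (a \<oplus> b) = emb a \<oplus>\<^bsub>D\<^esub> emb b"
    if "a \<in> carrier L" "b \<in> carrier L" for a b
    using that by (simp_all add: \<iota>_mult [symmetric] \<iota>_add [symmetric] constant_mult constant_add)
  have "constant \<one> = \<one>\<^bsub>S\<^esub>" by (simp add: skew_poly_simps)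
  then show "emb \<one> = \<one>\<^bsub>D\<^esub>" using \<iota>_one by simp
qed auto

lemma emb_inj: "a \<in> carrier L \<Longrightarrow> b \<in> carrier L \<Longrightarrow> emb a = emb b \<Longrightarrow> a = b"
proof -
  assume a: "a \<in> carrier L" and b: "b \<in> carrier L" and eq: "emb a = emb b"
  have "constant a = constant b" by (rule \<iota>_inj[OF monom_up[OF a] monom_up[OF b] eq])
  then have "constant a 0 = constant b 0" by simp
  then show "a = b" using a b by (simp add: skew_poly_simps(5))
qed

lemma one_neq_zero_D: "\<one>\<^bsub>D\<^esub> \<noteq> \<zero>\<^bsub>D\<^esub>"
proof -
  interpret emb: ring_hom_ring L D emb by (rule emb_hom)
  show ?thesis using emb_inj[of \<one> \<zero>] by auto
qed

lemma t_closed [simp, intro]: "t \<in> carrier D" by (auto simp: t_def)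

lemma t_unit: "t \<in> Units D"
proof -
  have "t \<noteq> \<zero>\<^bsub>D\<^esub>"
  proof
    assume "t = \<zero>\<^bsub>D\<^esub>"
    then have "\<iota> T = \<iota> (\<lambda>_. \<zero>)" by (simp add: t_def \<iota>_zero)
    then have "T = (\<lambda>_. \<zero>)"
      by (rule \<iota>_inj[rotated 2]) (auto intro!: mem_upI bound.intro)
    then have "T 1 = \<zero>" by metis
    then show False by (simp add: skew_poly_simps(5))
  qed
  then show ?thesis by (simp add: D_units)
qed

lemma emb_t: "a \<in> carrier L \<Longrightarrow> emb a \<otimes>\<^bsub>D\<^esub> t = t \<otimes>\<^bsub>D\<^esub> emb (\<sigma> a)"
  using constant_T[of a] by (simp only: t_def \<iota>_mult [symmetric] monom_up one_closed \<sigma>_closed)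

lemma conj_emb: "a \<in> carrier L \<Longrightarrow> inv\<^bsub>D\<^esub> t \<otimes>\<^bsub>D\<^esub> emb a \<otimes>\<^bsub>D\<^esub> t = emb (\<sigma> a)"
  using emb_t[of a] t_unit by (simp add: D.m_assoc) (simp add: D.m_assoc [symmetric])

lemma horner_image:
  "p \<in> up L \<Longrightarrow> a \<in> carrier L \<Longrightarrow>
    t \<otimes>\<^bsub>D\<^esub> \<iota> p \<oplus>\<^bsub>D\<^esub> emb a = \<iota> (T \<otimes>\<^bsub>S\<^esub> p \<oplus>\<^bsub>S\<^esub> constant a)"
  using T_mult_up[of p] by (simp only: t_def \<iota>_mult \<iota>_add monom_up one_closed)

lemma horner_up: "p \<in> up L \<Longrightarrow> a \<in> carrier L \<Longrightarrow> T \<otimes>\<^bsub>S\<^esub> p \<oplus>\<^bsub>S\<^esub> constant a \<in> up L"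
  using up_add_closed[OF T_mult_up monom_up] by (simp only: skew_poly_simps(4)[OF T_mult_up monom_up])

text \<open>
  Splitting off the constant coefficient is Horner's scheme: \<open>p = t p' + p\<^sub>0\<close>, where \<open>p'\<close> is \<open>p\<close> shifted by
  one place.
\<close>

lemma skew_polynomials_eq_image: "skew_polynomials D E t = \<iota> ` up L"
proof
  show "skew_polynomials D E t \<subseteq> \<iota> ` up L"
  proof
    fix x assume "x \<in> skew_polynomials D E t"
    then show "x \<in> \<iota> ` up L"
    proof (induction rule: skew_polynomials.induct)
      case (horner x a)
      then obtain p b where "p \<in> up L" "b \<in> carrier L" "x = \<iota> p" "a = emb b" by auto
      then show ?case using horner_image horner_up by auto
    qed auto
  qed
next
  have image: "\<iota> p \<in> skew_polynomials D E t" if "p \<in> up L" "\<And>m. n \<le> m \<Longrightarrow> p m = \<zero>" for n p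
    using that
  proof (induction n arbitrary: p)
    case 0
    then have "p = constant \<zero>" by (auto simp: skew_poly_simps)
    then show ?case by (auto intro: skew_polynomials.const)
  next
    case (Suc n)
    let ?p = "\<lambda>i. p (Suc i)"
    have p': "?p \<in> up L" using Suc.prems by (intro mem_upI) (auto intro!: bound.intro exI[of _ n])
    have "p = T \<otimes>\<^bsub>S\<^esub> ?p \<oplus>\<^bsub>S\<^esub> constant (p 0)"
      using Suc.prems(1) by (subst horner_coefficients[OF p']) (auto split: nat.split)
    then have "\<iota> p = t \<otimes>\<^bsub>D\<^esub> \<iota> ?p \<oplus>\<^bsub>D\<^esub> emb (p 0)"
      using horner_image[OF p', of "p 0"] Suc.prems(1) by simp
    moreover have "\<iota> ?p \<in> skew_polynomials D E t" using Suc.prems(2) by (intro Suc.IH p') auto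
    ultimately show ?case using Suc.prems(1) by (auto intro!: skew_polynomials.horner)
  qed
  show "\<iota> ` up L \<subseteq> skew_polynomials D E t"
  proof
    fix x assume "x \<in> \<iota> ` up L"
    then obtain p n where "p \<in> up L" "bound \<zero> n p" "x = \<iota> p" by blast
    then show "x \<in> skew_polynomials D E t" using image[of p "Suc n"] bound.bound[of \<zero> n p] by simp
  qed
qed

lemma skew_fractions: "skew_fractions D E t"
proof (intro skew_fractions.intro skew_fractions_axioms.intro)
  show "ring D" by (rule D.ring_axioms)
  show "Units D = carrier D - {\<zero>\<^bsub>D\<^esub>}" by (rule D_units)
  show "subfield E D"
    by (rule ring_hom_ring.img_is_subfield(2)[OF emb_hom carrier_is_subfield one_neq_zero_D])
  show "t \<in> carrier D" by (rule t_closed)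
  show "inv\<^bsub>D\<^esub> t \<otimes>\<^bsub>D\<^esub> a \<otimes>\<^bsub>D\<^esub> t \<in> E" if "a \<in> E" for a
    using that conj_emb by auto
next
  fix x a assume "x \<in> skew_polynomials D E t" "a \<in> E" and zero: "t \<otimes>\<^bsub>D\<^esub> x \<oplus>\<^bsub>D\<^esub> a = \<zero>\<^bsub>D\<^esub>"
  then obtain p b where p: "p \<in> up L" "b \<in> carrier L" "x = \<iota> p" "a = emb b"
    unfolding skew_polynomials_eq_image by blast
  have "\<iota> (T \<otimes>\<^bsub>S\<^esub> p \<oplus>\<^bsub>S\<^esub> constant b) = \<iota> (\<lambda>_. \<zero>)"
    using zero horner_image[OF p(1,2)] by (simp add: \<iota>_zero p(3,4))
  moreover have "(\<lambda>_. \<zero>) \<in> up L" by (auto intro!: mem_upI bound.intro)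
  ultimately have eq: "T \<otimes>\<^bsub>S\<^esub> p \<oplus>\<^bsub>S\<^esub> constant b = (\<lambda>_. \<zero>)"
    using \<iota>_inj[OF horner_up[OF p(1,2)]] by blast
  have "p m = \<zero>" for m
    using fun_cong[OF eq, of "Suc m"] by (simp only: horner_coefficients[OF p(1,2)] nat.case)
  then have "p = (\<lambda>_. \<zero>)" by auto
  then show "x = \<zero>\<^bsub>D\<^esub>" using \<iota>_zero p(3) by simp
next
  fix x assume "x \<in> carrier D"
  then obtain p q where "p \<in> up L" "q \<in> up L" "q \<noteq> \<zero>\<^bsub>S\<^esub>" "x = \<iota> p \<otimes>\<^bsub>D\<^esub> inv\<^bsub>D\<^esub> \<iota> q"
    using fractions unfolding division_ring_of_fractions_def skew_poly_simps(1) by blast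
  moreover from this have "\<iota> q \<noteq> \<zero>\<^bsub>D\<^esub>"
    using \<iota>_inj[of q "\<lambda>_. \<zero>"] \<iota>_zero by (auto simp: skew_poly_simps(2) intro!: mem_upI bound.intro)
  ultimately show "\<exists>p\<in>skew_polynomials D E t. \<exists>q\<in>skew_polynomials D E t - {\<zero>\<^bsub>D\<^esub>}. x = p \<otimes>\<^bsub>D\<^esub> inv\<^bsub>D\<^esub> q"
    unfolding skew_polynomials_eq_image by blast
qed

lemma twist_emb: "a \<in> carrier L \<Longrightarrow> skew_fractions.twist D t (emb a) = emb (\<sigma> a)"
  by (simp only: skew_fractions.twist_def[OF skew_fractions] conj_emb)

lemma fixed_field_eq: "skew_fractions.fixed_field D E t = emb ` K"
proof -
  have "skew_fractions.twist D t (emb a) = emb a \<longleftrightarrow> \<sigma> a = a" if "a \<in> carrier L" for a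
    using that twist_emb emb_inj[of "\<sigma> a" a] by auto
  then show ?thesis
    unfolding skew_fractions.fixed_field_def[OF skew_fractions] K_fixed by blast
qed

lemma separated_powers_emb:
  assumes A: "subring A L" "K \<subseteq> A" and diff: "(\<lambda>x. \<sigma> x \<ominus> x) ` carrier L \<inter> A \<subseteq> K"
    and f: "f \<in> A" "\<not> algebraic K f"
  shows "separated_powers D E t (emb f)"
proof (intro separated_powers.intro skew_fractions separated_powers_axioms.intro)
  have fL: "f \<in> carrier L" using f(1) subringE(1)[OF A(1)] by auto
  interpret emb: ring_hom_ring L D emb by (rule emb_hom)
  show "emb f \<in> E" using fL by auto
  fix i :: nat
  let ?U = "emb ` power_span f i"
  have pw: "emb f [^]\<^bsub>D\<^esub> j = emb (f [^] j)" for j :: nat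
    using fL by (induction j) auto
  note U = power_span_closed[OF fL, where i = i]
  have UL: "v \<in> carrier L" if "v \<in> power_span f i" for v using U(1) that by auto
  have "skew_fractions.fixed_subspace D E t ?U"
    unfolding skew_fractions.fixed_subspace_def[OF skew_fractions] fixed_field_eq
  proof (intro conjI ballI)
    show "?U \<subseteq> E" using U(1) by auto
    show "\<zero>\<^bsub>D\<^esub> \<in> ?U" using U(2) emb.hom_zero by (metis image_eqI)
  next
    fix x y assume "x \<in> ?U" "y \<in> ?U"
    then obtain v w where "v \<in> power_span f i" "w \<in> power_span f i" "x = emb v" "y = emb w" by auto
    then show "x \<oplus>\<^bsub>D\<^esub> y \<in> ?U"
      using U(3) UL by (intro image_eqI[of _ _ "v \<oplus> w"]) auto
  next
    fix x y assume "x \<in> ?U" "y \<in> emb ` K"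
    then obtain v k where "v \<in> power_span f i" "k \<in> K" "x = emb v" "y = emb k" by auto
    then show "y \<otimes>\<^bsub>D\<^esub> x \<in> ?U"
      using U(4) UL K_closed(1) by (intro image_eqI[of _ _ "k \<otimes> v"]) auto
  qed
  moreover have "emb f [^]\<^bsub>D\<^esub> j \<in> ?U" if "j \<noteq> i" for j
    using power_in_power_span[OF fL that] by (simp add: pw)
  moreover have "emb f [^]\<^bsub>D\<^esub> i \<notin> ?U"
  proof
    assume "emb f [^]\<^bsub>D\<^esub> i \<in> ?U"
    then obtain v where v: "v \<in> power_span f i" "emb (f [^] i) = emb v" by (auto simp: pw)
    then have "f [^] i = v" using fL UL by (intro emb_inj) auto
    then show False using power_not_in_power_span[OF A diff f, of i] v(1) by simp
  qed
  moreover have "skew_fractions.twist D t a \<ominus>\<^bsub>D\<^esub> a \<in> ?U" if i: "0 < i" and a: "a \<in> E" for a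
  proof -
    from a obtain b where b: "b \<in> carrier L" "a = emb b" by auto
    then have "skew_fractions.twist D t a \<ominus>\<^bsub>D\<^esub> a = emb (\<sigma> b \<ominus> b)"
      by (simp add: twist_emb minus_eq D.minus_eq)
    then show ?thesis using difference_in_power_span[OF fL i b(1)] by auto
  qed
  ultimately show "\<exists>U. skew_fractions.fixed_subspace D E t U \<and>
      (\<forall>j. j \<noteq> i \<longrightarrow> emb f [^]\<^bsub>D\<^esub> j \<in> U) \<and> emb f [^]\<^bsub>D\<^esub> i \<notin> U \<and>
      (0 < i \<longrightarrow> (\<forall>a\<in>E. skew_fractions.twist D t a \<ominus>\<^bsub>D\<^esub> a \<in> U))"
    by blast
qed

end

theorem theorem1p1:
  fixes L :: "('a, 'm) ring_scheme" and K A :: "'a set" and \<sigma> :: "'a \<Rightarrow> 'a" and f :: 'a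
    and D :: "('d, 'n) ring_scheme" and \<iota> :: "(nat \<Rightarrow> 'a) \<Rightarrow> 'd" and emb :: "'a \<Rightarrow> 'd" and t :: 'd
  assumes "field L" and "subfield K L" and "K \<noteq> carrier L"
    and "\<And>x. x \<in> carrier L \<Longrightarrow> ring.algebraic L K x \<Longrightarrow> x \<in> K"
    and "domain (tensor_square L K)"
    and "\<sigma> \<in> ring_iso L L" and "\<And>x. x \<in> K \<Longrightarrow> \<sigma> x = x"
    and "K = {x \<in> carrier L. \<sigma> x = x}"
    and "subring A L" and "subalgebra K A L" and "Frac_in L A = carrier L"
    and "(\<lambda>x. \<sigma> x \<ominus>\<^bsub>L\<^esub> x) ` carrier L \<inter> A \<subseteq> K"
    and "f \<in> A - K"
    and "division_ring_of_fractions (skew_poly L \<sigma>) D \<iota>"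
  defines "emb \<equiv> \<lambda>a. \<iota> (monom (skew_poly L \<sigma>) a 0)"
    and "t \<equiv> \<iota> (monom (skew_poly L \<sigma>) \<one>\<^bsub>L\<^esub> 1)"
  shows "free_generators D (emb ` K)
           (case_bool (emb f) (t \<otimes>\<^bsub>D\<^esub> inv\<^bsub>D\<^esub> (\<one>\<^bsub>D\<^esub> \<ominus>\<^bsub>D\<^esub> t) \<otimes>\<^bsub>D\<^esub> emb f))"
proof -
  interpret R: skew_fraction_ring L \<sigma> K D \<iota>
    using assms(1,2,6,8,14)
    by (intro skew_fraction_ring.intro difference_field.intro difference_field_axioms.intro
        skew_fraction_ring_axioms.intro) (auto simp: division_ring_of_fractions_def)
  have "k \<in> A" if k: "k \<in> K" for k
    using subalgebra.smult_closed[OF assms(10) k subringE(3)[OF assms(9)]] R.K_closed(1)[OF k] by simp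
  then have "K \<subseteq> A" by blast
  moreover have "\<not> ring.algebraic L K f"
    using assms(4)[of f] assms(13) subringE(1)[OF assms(9)] by auto
  ultimately have "separated_powers D R.E R.t (R.emb f)"
    using R.separated_powers_emb[OF assms(9) _ assms(12)] assms(13) by blast
  from separated_powers.free_generators_powers[OF this, unfolded R.fixed_field_eq] show ?thesis
    unfolding emb_def t_def R.t_def .
qed

end
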